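(* For $k=1,2,\ldots,s$, the LSQR iterate $x_k^{lsqr}$ is the solution of the problem $$\min\|x\|\quad\text{subject to}\quad\|P_{k+1}B_kQ_k^Tx-b\|=\min ,$$ that is, it is the minimum 2-norm minimizer of $\|P_{k+1}B_kQ_k^Tx-b\|$ over $x\in\mathbb{R}^n$. It is a regularized solution of the modified problem $\min_{x\in\mathbb{R}^n}\|A^{\prime}x-b\|$ and thus of the original problem $\min_{x\in\mathbb{R}^n}\|Ax-b\|$, and it satisfies $$\|Ax_k^{lsqr}-b\|=\|A^{\prime}x_k^{lsqr}-b\|=\|B_ky_k^{lsqr}-\beta_1e_1^{(k+1)}\|,\qquad k=1,2,\ldots,s.$$
   Context: $\|\cdot\|$ is the 2-norm. The problem $\min_x\|Ax-b\|$ is a linear discrete ill-posed problem: $b=b_{true}+e$ with $e$ a Gaussian white noise, $\|e\|<\|b_{true}\|$, and $x_{true}=A^{\dagger}b_{true}$ is the true solution sought. A regularized solution is meant in the usual descriptive sense: an approximation to $x_{true}$ obtained by replacing the ill-posed problem by a perturbed one, here the one in which $A^{\prime}$ is replaced by its rank $k$ approximation $P_{k+1}B_kQ_k^T$, with $k$ playing the role of the regularization parameter. Let $m\ge n$ and let $A\in\mathbb{R}^{m\times n}$ have the SVD $$A=\widehat U\begin{pmatrix}\Sigma\\ \mathbf 0\end{pmatrix}\widehat V^T,\qquad \Sigma=\mathrm{diag}(\sigma_1I_{c_1},\ldots,\sigma_sI_{c_s}),$$ with $\sigma_1>\sigma_2>\cdots>\sigma_s>0$ the distinct singular values, $\sigma_i$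 of multiplicity $c_i$, $c_1+\cdots+c_s=n$, and $\widehat U=(\widehat U_1,\ldots,\widehat U_s,\widehat U_\perp)\in\mathbb{R}^{m\times m}$, $\widehat V=(\widehat V_1,\ldots,\widehat V_s)\in\mathbb{R}^{n\times n}$ orthogonal, $\widehat U_i\in\mathbb{R}^{m\times c_i}$, $\widehat V_i\in\mathbb{R}^{n\times c_i}$. Let $\widehat U_i^Tb\neq 0$ for $i=1,\ldots,s$. Define $$u_i=\frac{\widehat U_i\widehat U_i^Tb}{\|\widehat U_i^Tb\|},\qquad v_i=\frac{A^Tu_i}{\sigma_i},\qquad i=1,\ldots,s.$$ For each $i$ complete $u_i$ to an orthonormal basis of the column space of $\widehat U_i$, and map the additional $c_i-1$ vectors $u$ to $A^Tu/\sigma_i$, so that together with $v_i$ these form an orthonormal basis of the column space of $\widehat V_i$. Let $U_\perp\in\mathbb{R}^{m\times(n-s)}$ and $V_\perp\in\mathbb{R}^{n\times(n-s)}$ collect all the additional left and right vectors, let $U=(u_1,\ldots,u_s,U_\perp)$, $V=(v_1,\ldots,v_s,V_\perp)$, and define $$A^{\prime}=U\,\mathrm{diag}(\sigma_1,\ldots,\sigma_s,0,\ldots,0)\,V^T\in\mathbb{R}^{m\times n}.$$ Golub-Kahan bidiagonalization: $\beta_1=\|b\|$, $p_1=b/\beta_1$, $q_0=\mathbf 0$, and for $j=1,2,\ldots$: $r=A^Tp_j-\beta_jq_{j-1}$, $\alpha_j=\|r\|$, $q_j=r/\alpha_j$; $z=Aq_j-\alpha_jp_j$, $\beta_{j+1}=\|z\|$,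 $p_{j+1}=z/\beta_{j+1}$. In the present setting it does not break down before step $s$. Put $P_{k+1}=(p_1,\ldots,p_{k+1})$, $Q_k=(q_1,\ldots,q_k)$ (orthonormal columns), and let $B_k\in\mathbb{R}^{(k+1)\times k}$ be lower bidiagonal with diagonal entries $\alpha_1,\ldots,\alpha_k$ and subdiagonal entries $\beta_2,\ldots,\beta_{k+1}$. Let $e_1^{(k+1)}$ be the first canonical basis vector of $\mathbb{R}^{k+1}$. If $\beta_{s+1}=0$ (e.g. when $m=n$), then for $k=s$ one replaces $P_{s+1}$ by $P_s$, $B_s$ by its leading $s\times s$ block, and $e_1^{(s+1)}$ by $e_1^{(s)}$. The LSQR iterate $x_k^{lsqr}$ is the minimizer of $\|Ax-b\|$ over the Krylov subspace $\mathcal K_k(A^TA,A^Tb)=\mathrm{span}\{A^Tb,(A^TA)A^Tb,\ldots,(A^TA)^{k-1}A^Tb\}$; it is given by $x_k^{lsqr}=Q_ky_k^{lsqr}$ with $y_k^{lsqr}=\arg\min_{y\in\mathbb{R}^k}\|B_ky-\beta_1e_1^{(k+1)}\|$. *)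

theory Defs
  imports "HOL-Probability.Probability" "Jordan_Normal_Form.DL_Rank"
begin

no_notation Finite_Cartesian_Product.vec_nth (infixl \<open>$\<close> 90)
hide_const (open) Finite_Cartesian_Product.vec Finite_Cartesian_Product.mat
  Finite_Cartesian_Product.row Finite_Cartesian_Product.column
  Finite_Cartesian_Product.transpose Determinants.det Cartesian_Space.rank
hide_type (open) Finite_Cartesian_Product.vec

definition vnorm :: "real vec \<Rightarrow> real" where
  "vnorm x = sqrt (x \<bullet> x)"

definition vspan :: "nat \<Rightarrow> real vec set \<Rightarrow> real vec set" where
  "vspan d S = LinearCombinations.module.span class_ring (module_vec TYPE(real) d) S"

definition orthonormal_columns :: "real mat \<Rightarrow> bool" where
  "orthonormal_columns X \<longleftrightarrow> X\<^sup>T * X = 1\<^sub>m (dim_col X)"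

text \<open>The predicate \<^const>\<open>orthogonal_mat\<close> of the library does not normalise the columns.\<close>

definition real_orthogonal :: "nat \<Rightarrow> real mat \<Rightarrow> bool" where
  "real_orthogonal d X \<longleftrightarrow> X \<in> carrier_mat d d \<and> orthonormal_columns X"

definition orthonormal_basis_of :: "nat \<Rightarrow> real vec list \<Rightarrow> real vec set \<Rightarrow> bool" where
  "orthonormal_basis_of d ws S \<longleftrightarrow>
     set ws \<subseteq> carrier_vec d \<and> orthonormal_columns (mat_of_cols d ws) \<and> vspan d (set ws) = S"

subsection \<open>Least squares\<close>

definition ls_solutions :: "real mat \<Rightarrow> real vec \<Rightarrow> real vec set" where
  "ls_solutions C b =
     {x. is_arg_min (\<lambda>x. vnorm (C *\<^sub>v x - b)) (\<lambda>x. x \<in> carrier_vec (dim_col C)) x}"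

definition min_norm_ls_solution :: "real mat \<Rightarrow> real vec \<Rightarrow> real vec \<Rightarrow> bool" where
  "min_norm_ls_solution C b x \<longleftrightarrow> is_arg_min vnorm (\<lambda>x. x \<in> ls_solutions C b) x"

definition moore_penrose :: "real mat \<Rightarrow> real mat" where
  "moore_penrose A = (THE X. X \<in> carrier_mat (dim_col A) (dim_row A) \<and>
     A * X * A = A \<and> X * A * X = X \<and> (A * X)\<^sup>T = A * X \<and> (X * A)\<^sup>T = X * A)"

subsection \<open>Noise\<close>

text \<open>\<open>E\<close> is a random vector in \<open>\<real>\<^sup>m\<close> whose components are independent, centred Gaussians
  with common standard deviation \<open>\<eta>\<close>.\<close>

definition gaussian_white_noise :: "'w measure \<Rightarrow> real \<Rightarrow> nat \<Rightarrow> ('w \<Rightarrow> real vec) \<Rightarrow> bool" where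
  "gaussian_white_noise \<Omega> \<eta> m E \<longleftrightarrow>
     prob_space \<Omega> \<and> \<eta> > 0 \<and> (\<forall>\<omega>\<in>space \<Omega>. E \<omega> \<in> carrier_vec m) \<and>
     prob_space.indep_vars \<Omega> (\<lambda>_. borel) (\<lambda>i \<omega>. E \<omega> $ i) {..<m} \<and>
     (\<forall>i<m. distributed \<Omega> lborel (\<lambda>\<omega>. E \<omega> $ i) (normal_density 0 \<eta>))"

subsection \<open>Singular value decomposition with grouped singular values\<close>

text \<open>Singular values and their multiplicities are indexed by \<open>1, \<dots>, s\<close>;
  matrix and vector positions start at \<open>0\<close>.\<close>

definition grouped_svd ::
  "nat \<Rightarrow> nat \<Rightarrow> real mat \<Rightarrow> nat \<Rightarrow> (nat \<Rightarrow> real) \<Rightarrow> (nat \<Rightarrow> nat) \<Rightarrow> real mat \<Rightarrow> real mat \<Rightarrow> bool" where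
  "grouped_svd m n A s \<sigma> c Uh Vh \<longleftrightarrow>
     real_orthogonal m Uh \<and> real_orthogonal n Vh \<and>
     (\<forall>i\<in>{1..s}. \<sigma> i > 0) \<and> (\<forall>i\<in>{1..s}. \<forall>j\<in>{1..s}. i < j \<longrightarrow> \<sigma> i > \<sigma> j) \<and>
     (\<forall>i\<in>{1..s}. c i \<ge> 1) \<and> (\<Sum>i=1..s. c i) = n \<and>
     A = Uh * (diag_block_mat (map (\<lambda>i. \<sigma> i \<cdot>\<^sub>m 1\<^sub>m (c i)) [1..<Suc s]) @\<^sub>r 0\<^sub>m (m - n) n) * Vh\<^sup>T"

text \<open>The \<open>i\<close>-th column block, of width \<open>c i\<close>, of a matrix partitioned according to \<open>c\<close>.\<close>

definition col_block :: "(nat \<Rightarrow> nat) \<Rightarrow> real mat \<Rightarrow> nat \<Rightarrow> real mat" where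
  "col_block c X i = (let d = (\<Sum>j=1..<i. c j) in
     mat_of_cols (dim_row X) (map (col X) [d..<d + c i]))"

definition svd_u :: "(nat \<Rightarrow> nat) \<Rightarrow> real mat \<Rightarrow> real vec \<Rightarrow> nat \<Rightarrow> real vec" where
  "svd_u c Uh b i = (let Ui = col_block c Uh i in
     (1 / vnorm (Ui\<^sup>T *\<^sub>v b)) \<cdot>\<^sub>v (Ui *\<^sub>v (Ui\<^sup>T *\<^sub>v b)))"

definition right_vec :: "real mat \<Rightarrow> real \<Rightarrow> real vec \<Rightarrow> real vec" where
  "right_vec A t u = (1 / t) \<cdot>\<^sub>v (A\<^sup>T *\<^sub>v u)"

text \<open>\<open>W i\<close> lists the \<open>c i - 1\<close> vectors which complete \<open>u\<^sub>i\<close> to an orthonormal basis of the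
  column space of the \<open>i\<close>-th block of \<open>Uh\<close>.\<close>

definition svd_completion ::
  "nat \<Rightarrow> nat \<Rightarrow> (nat \<Rightarrow> nat) \<Rightarrow> real mat \<Rightarrow> real vec \<Rightarrow> (nat \<Rightarrow> real vec list) \<Rightarrow> bool" where
  "svd_completion m s c Uh b W \<longleftrightarrow> (\<forall>i\<in>{1..s}. length (W i) = c i - 1 \<and>
     orthonormal_basis_of m (svd_u c Uh b i # W i) (vspan m (set (cols (col_block c Uh i)))))"

definition modified_U ::
  "nat \<Rightarrow> nat \<Rightarrow> (nat \<Rightarrow> nat) \<Rightarrow> real mat \<Rightarrow> real vec \<Rightarrow> (nat \<Rightarrow> real vec list) \<Rightarrow> real mat" where
  "modified_U m s c Uh b W =
     mat_of_cols m (map (svd_u c Uh b) [1..<Suc s] @ concat (map W [1..<Suc s]))"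

definition modified_V ::
  "real mat \<Rightarrow> nat \<Rightarrow> (nat \<Rightarrow> real) \<Rightarrow> (nat \<Rightarrow> nat) \<Rightarrow> real mat \<Rightarrow> real vec
     \<Rightarrow> (nat \<Rightarrow> real vec list) \<Rightarrow> real mat" where
  "modified_V A s \<sigma> c Uh b W =
     mat_of_cols (dim_col A)
       (map (\<lambda>i. right_vec A (\<sigma> i) (svd_u c Uh b i)) [1..<Suc s] @
        concat (map (\<lambda>i. map (right_vec A (\<sigma> i)) (W i)) [1..<Suc s]))"

definition modified_mat ::
  "real mat \<Rightarrow> nat \<Rightarrow> (nat \<Rightarrow> real) \<Rightarrow> (nat \<Rightarrow> nat) \<Rightarrow> real mat \<Rightarrow> real vec
     \<Rightarrow> (nat \<Rightarrow> real vec list) \<Rightarrow> real mat" where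
  "modified_mat A s \<sigma> c Uh b W =
     modified_U (dim_row A) s c Uh b W
       * mat_diag (dim_col A) (\<lambda>i. if i < s then \<sigma> (Suc i) else 0)
       * (modified_V A s \<sigma> c Uh b W)\<^sup>T"

subsection \<open>Golub-Kahan bidiagonalization and LSQR\<close>

text \<open>\<open>golub_kahan A b j\<close> is \<open>(\<alpha>\<^sub>j, \<beta>\<^sub>j\<^sub>+\<^sub>1, p\<^sub>j\<^sub>+\<^sub>1, q\<^sub>j)\<close>, with a dummy \<open>\<alpha>\<^sub>0 = 0\<close>.
  After a breakdown the convention \<open>1 / 0 = 0\<close> produces zero vectors.\<close>

primrec golub_kahan ::
  "real mat \<Rightarrow> real vec \<Rightarrow> nat \<Rightarrow> real \<times> real \<times> real vec \<times> real vec" where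
  "golub_kahan A b 0 = (0, vnorm b, (1 / vnorm b) \<cdot>\<^sub>v b, 0\<^sub>v (dim_col A))"
| "golub_kahan A b (Suc j) =
     (let (_, \<beta>, p, q) = golub_kahan A b j;
          r = A\<^sup>T *\<^sub>v p - \<beta> \<cdot>\<^sub>v q;
          \<alpha>' = vnorm r;
          q' = (1 / \<alpha>') \<cdot>\<^sub>v r;
          z = A *\<^sub>v q' - \<alpha>' \<cdot>\<^sub>v p;
          \<beta>' = vnorm z
      in (\<alpha>', \<beta>', (1 / \<beta>') \<cdot>\<^sub>v z, q'))"

text \<open>The scalars and vectors in their usual numbering; all are meant for \<open>j \<ge> 1\<close>.\<close>

definition gk_alpha :: "real mat \<Rightarrow> real vec \<Rightarrow> nat \<Rightarrow> real" where
  "gk_alpha A b j = (case golub_kahan A b j of (\<alpha>, _, _, _) \<Rightarrow> \<alpha>)"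

definition gk_beta :: "real mat \<Rightarrow> real vec \<Rightarrow> nat \<Rightarrow> real" where
  "gk_beta A b j = (case golub_kahan A b (j - 1) of (_, \<beta>, _, _) \<Rightarrow> \<beta>)"

definition gk_p :: "real mat \<Rightarrow> real vec \<Rightarrow> nat \<Rightarrow> real vec" where
  "gk_p A b j = (case golub_kahan A b (j - 1) of (_, _, p, _) \<Rightarrow> p)"

definition gk_q :: "real mat \<Rightarrow> real vec \<Rightarrow> nat \<Rightarrow> real vec" where
  "gk_q A b j = (case golub_kahan A b j of (_, _, _, q) \<Rightarrow> q)"

text \<open>The number of left vectors used at step \<open>k\<close>: it is \<open>k + 1\<close>, except that it is \<open>s\<close>
  when \<open>k = s\<close> and \<open>\<beta>\<^sub>s\<^sub>+\<^sub>1 = 0\<close>.\<close>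

definition gk_rows :: "real mat \<Rightarrow> real vec \<Rightarrow> nat \<Rightarrow> nat \<Rightarrow> nat" where
  "gk_rows A b s k = (if k = s \<and> gk_beta A b (s + 1) = 0 then s else k + 1)"

definition gk_P :: "real mat \<Rightarrow> real vec \<Rightarrow> nat \<Rightarrow> nat \<Rightarrow> real mat" where
  "gk_P A b s k = mat_of_cols (dim_row A) (map (gk_p A b) [1..<Suc (gk_rows A b s k)])"

definition gk_Q :: "real mat \<Rightarrow> real vec \<Rightarrow> nat \<Rightarrow> real mat" where
  "gk_Q A b k = mat_of_cols (dim_col A) (map (gk_q A b) [1..<Suc k])"

definition gk_B :: "real mat \<Rightarrow> real vec \<Rightarrow> nat \<Rightarrow> nat \<Rightarrow> real mat" where
  "gk_B A b s k = mat (gk_rows A b s k) k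
     (\<lambda>(i, j). if i = j then gk_alpha A b (j + 1)
               else if i = j + 1 then gk_beta A b (j + 2) else 0)"

definition gk_rhs :: "real mat \<Rightarrow> real vec \<Rightarrow> nat \<Rightarrow> nat \<Rightarrow> real vec" where
  "gk_rhs A b s k = gk_beta A b 1 \<cdot>\<^sub>v unit_vec (gk_rows A b s k) 0"

definition krylov :: "nat \<Rightarrow> real mat \<Rightarrow> real vec \<Rightarrow> real vec set" where
  "krylov k M w = vspan (dim_vec w) {(M ^\<^sub>m i) *\<^sub>v w | i. i < k}"

definition lsqr_iterate :: "real mat \<Rightarrow> real vec \<Rightarrow> nat \<Rightarrow> real vec" where
  "lsqr_iterate A b k =
     arg_min_on (\<lambda>x. vnorm (A *\<^sub>v x - b)) (krylov k (A\<^sup>T * A) (A\<^sup>T *\<^sub>v b))"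

definition lsqr_y :: "real mat \<Rightarrow> real vec \<Rightarrow> nat \<Rightarrow> nat \<Rightarrow> real vec" where
  "lsqr_y A b s k =
     arg_min_on (\<lambda>y. vnorm (gk_B A b s k *\<^sub>v y - gk_rhs A b s k)) (carrier_vec k)"

subsection \<open>Regularized solutions\<close>

text \<open>\<open>P B Q\<^sup>T\<close> is a rank \<open>k\<close> approximation of \<open>M\<close> by projection: it has rank \<open>k\<close> and
  equals \<open>P P\<^sup>T M Q Q\<^sup>T\<close>, the best Frobenius-norm approximation of \<open>M\<close> among all matrices of
  the form \<open>P X Q\<^sup>T\<close>.\<close>

definition rank_approximation ::
  "real mat \<Rightarrow> nat \<Rightarrow> real mat \<Rightarrow> real mat \<Rightarrow> real mat \<Rightarrow> bool" where
  "rank_approximation M k P B Q \<longleftrightarrow>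
     orthonormal_columns P \<and> orthonormal_columns Q \<and>
     vec_space.rank (dim_row M) (P * B * Q\<^sup>T) = k \<and>
     P * B * Q\<^sup>T = (P * P\<^sup>T) * M * (Q * Q\<^sup>T)"

text \<open>In the problem of minimizing \<open>\<parallel>M x - b\<parallel>\<close>, the matrix \<open>M\<close> is replaced by its rank \<open>k\<close>
  approximation \<open>P B Q\<^sup>T\<close>, and \<open>x\<close> is the minimum norm solution of the replaced problem; \<open>k\<close> is
  the regularization parameter.\<close>

definition regularized_solution ::
  "real mat \<Rightarrow> real vec \<Rightarrow> nat \<Rightarrow> real mat \<Rightarrow> real mat \<Rightarrow> real mat \<Rightarrow> real vec \<Rightarrow> bool" where
  "regularized_solution M b k P B Q x \<longleftrightarrow>
     rank_approximation M k P B Q \<and> min_norm_ls_solution (P * B * Q\<^sup>T) b x"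

end

theory Submission
  imports Defs
begin

text \<open>Two facts carry the proof. First, the Golub-Kahan recurrences give \<open>A Q = P B\<close>, so
  \<open>P B Q\<^sup>T = A Q Q\<^sup>T\<close>, and the columns of \<open>Q\<close> span the Krylov space. Hence the minimizers of
  \<open>\<parallel>P B Q\<^sup>T x - b\<parallel>\<close> are the \<open>x\<close> whose orthogonal projection \<open>Q Q\<^sup>T x\<close> onto the Krylov space
  is the LSQR iterate, and the shortest of them is the iterate itself. Second, \<open>A\<^sup>T b\<close> lies in the
  span of \<open>v\<^sub>1, \<dots>, v\<^sub>s\<close>, which is invariant under \<open>A\<^sup>T A\<close> and on which \<open>A\<close> and \<open>A'\<close> agree;
  so \<open>A' Q = A Q\<close>.\<close>

text \<open>The main obstacle is breakdown. Orthonormality of \<open>P\<close> and \<open>Q\<close>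
  and injectivity of \<open>B\<close> all rest on nonzero \<open>\<alpha>\<close> and
  \<open>\<beta>\<close> up to step \<open>s\<close>, and this is derived from the singular value
  decomposition by counting roots: the vectors are polynomials in the \<open>s\<close> distinct
  eigenvalues \<open>(\<sigma> i)^2\<close>, at each of which \<open>b\<close> has a nonzero
  component. The count does not reach \<open>\<beta> (Suc s)\<close>, whence the exceptional shape
  of \<open>P\<close> and \<open>B\<close> at \<open>k = s\<close>. The choice of \<open>u i\<close>
  as the normalised projection of \<open>b\<close> onto a block of left singular vectors is what
  lets one direction per distinct singular value carry all of \<open>A^T b\<close>, however large
  the multiplicity. The modified matrix is then handled as \<open>A * Z\<close>, where
  \<open>Z = N * N^T\<close> and the columns of \<open>N\<close> are the right vectors. Both
  \<open>lsqr_iterate\<close> and \<open>lsqr_y\<close> are defined by a choice operator, so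
  existence and uniqueness of minimizers have to be established before anything can be said about
  them. One vector, the solution of the normal equations of \<open>P * B\<close>, settles all the
  minimization problems at once.\<close>

no_notation inner (infix \<open>\<bullet>\<close> 70)

section \<open>Spans and least squares over the reals\<close>

lemma vnorm_eq_0_iff: "x \<in> carrier_vec d \<Longrightarrow> vnorm x = 0 \<longleftrightarrow> x = 0\<^sub>v d"
  unfolding vnorm_def by (auto simp: scalar_prod_def sum_nonneg_eq_0_iff power2_eq_square[symmetric] intro!: eq_vecI)

lemma scalar_prod_self_nonneg: "0 \<le> x \<bullet> (x :: real vec)"
  by (auto simp: scalar_prod_def intro!: sum_nonneg)

lemma vnorm_power2: "(vnorm x)\<^sup>2 = x \<bullet> x"
  by (simp add: vnorm_def scalar_prod_self_nonneg)

lemma vnorm_nonneg: "0 \<le> vnorm x"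
  by (simp add: vnorm_def scalar_prod_self_nonneg)

lemma vnorm_normalise: "vnorm x \<noteq> 0 \<Longrightarrow> ((1 / vnorm x) \<cdot>\<^sub>v x) \<bullet> ((1 / vnorm x) \<cdot>\<^sub>v x) = 1"
  using vnorm_power2[of x] by (auto simp: power2_eq_square divide_simps)

text \<open>The zero vector is covered because \<open>1 / 0 = 0\<close>. This is why the recurrences
  \<open>At_p\<close> and \<open>A_q\<close> hold at every index, even across a breakdown.\<close>

lemma smult_normalise: "vnorm x \<cdot>\<^sub>v ((1 / vnorm x) \<cdot>\<^sub>v x) = x"
proof (cases "vnorm x = 0")
  case True
  hence "x = 0\<^sub>v (dim_vec x)" using vnorm_eq_0_iff[of x "dim_vec x"] by simp
  with True show ?thesis by (intro eq_vecI) (auto, metis index_zero_vec(1))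
qed (simp add: smult_smult_assoc)

text \<open>The bridge from spans of sets to ranges of matrices: it turns minimization over a Krylov
  space into minimization over coefficient vectors.\<close>

lemma vspan_cols:
  assumes C: "C \<in> carrier_mat d k"
  shows "vspan d (set (cols C)) = {C *\<^sub>v y |y. y \<in> carrier_vec k}"
proof -
  interpret vec_space "TYPE(real)" d .
  have ws: "set (cols C) \<subseteq> carrier_vec d"
    using C cols_dim[of C] by auto
  have *: "lincomb_list f (cols C) = C *\<^sub>v vec k f" for f
    using lincomb_list_as_mat_mult[of "cols C" f] ws C mat_of_cols_cols[of C]
    by (metis carrier_matD carrier_vecD cols_length subsetD)
  have "vspan d (set (cols C)) = span_list (cols C)"
    by (simp add: vspan_def span_list_as_span[OF ws])
  also have "\<dots> = {C *\<^sub>v y |y. y \<in> carrier_vec k}"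
  proof -
    have "\<exists>f. y = vec k f" if "y \<in> carrier_vec k" for y :: "real vec"
      using that by (intro exI[of _ "\<lambda>i. y $ i"]) auto
    thus ?thesis
      unfolding span_list_def * by fastforce
  qed
  finally show ?thesis .
qed

lemma vspan_subsetI: "T \<subseteq> carrier_vec d \<Longrightarrow> S \<subseteq> vspan d T \<Longrightarrow> vspan d S \<subseteq> vspan d T"
  unfolding vspan_def
proof -
  interpret vec_space "TYPE(real)" d .
  show "span S \<subseteq> span T" if "T \<subseteq> carrier_vec d" "S \<subseteq> span T"
    using that by (rule span_subsetI)
qed

context
  fixes d :: nat and S :: "real vec set"
  assumes S: "S \<subseteq> carrier_vec d"
begin



interpretation vec_space "TYPE(real)" d .

lemma vspan_carrier: "vspan d S \<subseteq> carrier_vec d"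
  using span_is_subset2[OF S] by (simp add: vspan_def)

lemma vspan_superset: "S \<subseteq> vspan d S"
  using in_own_span[OF S] by (simp add: vspan_def)

lemma vspan_add: "x \<in> vspan d S \<Longrightarrow> y \<in> vspan d S \<Longrightarrow> x + y \<in> vspan d S"
  using span_add1[OF S] by (simp add: vspan_def)

lemma vspan_smult: "x \<in> vspan d S \<Longrightarrow> t \<cdot>\<^sub>v x \<in> vspan d S"
  using smult_in_span[OF S] by (simp add: vspan_def)

lemma vspan_zero: "0\<^sub>v d \<in> vspan d S"
  using vspan_smult[of _ 0] S unfolding vspan_def
  by (auto simp: span_def lincomb_def intro!: exI[of _ "{}"])

lemma vspan_diff:
  assumes "x \<in> vspan d S" "y \<in> vspan d S"
  shows "x - y \<in> vspan d S"
proof -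
  have "x - y = x + (-1) \<cdot>\<^sub>v y"
    using assms vspan_carrier by (intro eq_vecI) auto
  thus ?thesis
    using assms by (simp add: vspan_add vspan_smult)
qed

end

lemma vspan_image:
  assumes S: "finite S" "S \<subseteq> carrier_vec d" and T: "T \<subseteq> carrier_vec e" and C: "C \<in> carrier_mat e d"
    and image: "\<And>w. w \<in> S \<Longrightarrow> C *\<^sub>v w \<in> vspan e T" and x: "x \<in> vspan d S"
  shows "C *\<^sub>v x \<in> vspan e T"
proof -
  obtain ws where ws: "S = set ws" using finite_list[OF S(1)] by blast
  let ?X = "mat_of_cols d ws"
  have X: "?X \<in> carrier_mat d (length ws)" by simp
  have cols: "cols ?X = ws" using S ws by simp
  obtain y where y: "y \<in> carrier_vec (length ws)" "x = ?X *\<^sub>v y"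
    using x vspan_cols[OF X] cols ws by auto
  have "C *\<^sub>v x = (C * ?X) *\<^sub>v y"
    using assoc_mult_mat_vec[OF C X] y by simp
  also have "\<dots> \<in> vspan e (set (cols (C * ?X)))"
    using vspan_cols[of "C * ?X" e "length ws"] C X y by auto
  also have "\<dots> \<subseteq> vspan e T"
  proof (rule vspan_subsetI[OF T])
    show "set (cols (C * ?X)) \<subseteq> vspan e T"
    proof
      fix z assume "z \<in> set (cols (C * ?X))"
      then obtain j where j: "j < length ws" "z = col (C * ?X) j"
        by (auto simp: cols_def)
      have wj: "ws ! j \<in> carrier_vec d" using j S ws by auto
      have "z = C *\<^sub>v (ws ! j)"
        unfolding j(2) using C X j(1) wj by (subst col_mult2[OF C X]) auto
      thus "z \<in> vspan e T" using image j(1) ws by auto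
    qed
  qed
  finally show ?thesis .
qed

lemma vspan_cong_mult:
  assumes S: "finite S" "S \<subseteq> carrier_vec d" and C: "C \<in> carrier_mat e d" and D: "D \<in> carrier_mat e d"
    and eq: "\<And>w. w \<in> S \<Longrightarrow> C *\<^sub>v w = D *\<^sub>v w" and x: "x \<in> vspan d S"
  shows "C *\<^sub>v x = D *\<^sub>v x"
proof -
  obtain ws where ws: "S = set ws" using finite_list[OF S(1)] by blast
  let ?X = "mat_of_cols d ws"
  have X: "?X \<in> carrier_mat d (length ws)" by simp
  have cols: "cols ?X = ws" using S ws by simp
  obtain y where y: "y \<in> carrier_vec (length ws)" "x = ?X *\<^sub>v y"
    using x vspan_cols[OF X] cols ws by auto
  have "C * ?X = D * ?X"
  proof (rule mat_col_eqI)
    fix j assume "j < dim_col (D * ?X)"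
    hence j: "j < length ws" by simp
    hence "ws ! j \<in> S" "ws ! j \<in> carrier_vec d" using S ws by auto
    thus "col (C * ?X) j = col (D * ?X) j"
      using col_mult2[OF C X j] col_mult2[OF D X j] eq j by simp
  qed (use C D in simp_all)
  thus ?thesis
    using assoc_mult_mat_vec[OF C X y(1)] assoc_mult_mat_vec[OF D X y(1)] y(2) by simp
qed

section \<open>Rank and normal equations of an injective matrix\<close>

lemma mult_unit_vec:
  "C \<in> carrier_mat m k \<Longrightarrow> i < k \<Longrightarrow> C *\<^sub>v unit_vec k i = col C (i :: nat)" for C :: "real mat"
  by (intro eq_vecI) auto

lemma rank_injective:
  fixes C :: "real mat"
  assumes C: "C \<in> carrier_mat m k"
    and inj: "\<And>y. y \<in> carrier_vec k \<Longrightarrow> C *\<^sub>v y = 0\<^sub>v m \<Longrightarrow> y = 0\<^sub>v k"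
  shows "vec_space.rank m C = k"
proof -
  interpret vec_space "TYPE(real)" m .
  \<comment> \<open>Independence concerns the set of columns, in which a repeated column would be
    lost. Two equal columns would put a difference of unit vectors into the kernel.\<close>
  have "distinct (cols C)"
    unfolding distinct_conv_nth
  proof (intro allI impI)
    fix i j assume ij: "i < length (cols C)" "j < length (cols C)" "i \<noteq> j"
    have "unit_vec k i - unit_vec k j \<noteq> (0\<^sub>v k :: real vec)"
    proof
      assume "unit_vec k i - unit_vec k j = (0\<^sub>v k :: real vec)"
      hence "(unit_vec k i - unit_vec k j) $ i = (0\<^sub>v k :: real vec) $ i" by simp
      thus False using ij C by simp
    qed
    hence "C *\<^sub>v (unit_vec k i - unit_vec k j) \<noteq> 0\<^sub>v m"
      using inj[of "unit_vec k i - unit_vec k j"] by auto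
    moreover have "C *\<^sub>v (unit_vec k i - unit_vec k j) = col C i - col C j"
      using C ij by (simp add: mult_minus_distrib_mat_vec[OF C] mult_unit_vec[OF C])
    ultimately show "cols C ! i \<noteq> cols C ! j"
      using C ij by auto
  qed
  moreover from this have "lin_indpt (set (cols C))"
    using lin_depE[OF C] inj by metis
  ultimately show ?thesis
    using lin_indpt_full_rank[OF C] by blast
qed

text \<open>The rank is the dimension of the column span, which is the range.\<close>

lemma rank_cong:
  fixes C D :: "real mat"
  assumes C: "C \<in> carrier_mat m k" and D: "D \<in> carrier_mat m l"
    and range: "{C *\<^sub>v y |y. y \<in> carrier_vec k} = {D *\<^sub>v y |y. y \<in> carrier_vec l}"
  shows "vec_space.rank m C = vec_space.rank m D"
  using vspan_cols[OF C] vspan_cols[OF D] range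
  by (simp add: vec_space.rank_def vspan_def)

text \<open>A kernel vector \<open>v\<close> of \<open>C^T C\<close> satisfies
  \<open>(C v) . (C v) = 0\<close>, so injectivity of \<open>C\<close> makes the Gram matrix
  invertible and the normal equations solvable.\<close>

lemma least_squares_exists:
  fixes C :: "real mat"
  assumes C: "C \<in> carrier_mat m k" and b: "b \<in> carrier_vec m"
    and inj: "\<And>y. y \<in> carrier_vec k \<Longrightarrow> C *\<^sub>v y = 0\<^sub>v m \<Longrightarrow> y = 0\<^sub>v k"
  obtains y where "y \<in> carrier_vec k" "C\<^sup>T *\<^sub>v (C *\<^sub>v y - b) = 0\<^sub>v k"
proof -
  let ?G = "C\<^sup>T * C"
  have G: "?G \<in> carrier_mat k k" using C by simp
  have "det ?G \<noteq> 0"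
  proof
    assume "det ?G = 0"
    then obtain v where v: "v \<in> carrier_vec k" "v \<noteq> 0\<^sub>v k" "?G *\<^sub>v v = 0\<^sub>v k"
      using det_0_iff_vec_prod_zero[OF G] by auto
    have "(C *\<^sub>v v) \<bullet> (C *\<^sub>v v) = (C\<^sup>T *\<^sub>v (C *\<^sub>v v)) \<bullet> v"
      by (rule transpose_vec_mult_scalar[symmetric, OF C]) (use C v in auto)
    also have "\<dots> = 0" using v C by simp
    finally have "vnorm (C *\<^sub>v v) = 0" by (simp add: vnorm_def)
    hence "C *\<^sub>v v = 0\<^sub>v m" using vnorm_eq_0_iff[of "C *\<^sub>v v" m] C v by simp
    thus False using inj v by blast
  qed
  then obtain G' where G': "G' \<in> carrier_mat k k" "?G * G' = 1\<^sub>m k"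
    using det_non_zero_imp_unit[OF G] by (auto simp: Units_def ring_mat_def)
  let ?y = "G' *\<^sub>v (C\<^sup>T *\<^sub>v b)"
  have y: "?y \<in> carrier_vec k" using G' C b by simp
  have "C\<^sup>T *\<^sub>v (C *\<^sub>v ?y) = ?G *\<^sub>v ?y" using C y by simp
  also have "\<dots> = (?G * G') *\<^sub>v (C\<^sup>T *\<^sub>v b)"
    by (rule assoc_mult_mat_vec[symmetric, OF G G'(1)]) (use C b in auto)
  also have "\<dots> = C\<^sup>T *\<^sub>v b" using G' C b by simp
  finally have "C\<^sup>T *\<^sub>v (C *\<^sub>v ?y) = C\<^sup>T *\<^sub>v b" .
  hence "C\<^sup>T *\<^sub>v (C *\<^sub>v ?y - b) = 0\<^sub>v k"
    using C b y by (subst mult_minus_distrib_mat_vec[of _ k m]) auto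
  with y show ?thesis by (rule that)
qed

lemma pythagoras:
  assumes "x \<in> carrier_vec d" "y \<in> carrier_vec d" "x \<bullet> y = 0"
  shows "(vnorm (x + y))\<^sup>2 = (vnorm x)\<^sup>2 + (vnorm y)\<^sup>2"
  using assms comm_scalar_prod[OF assms(1,2)]
  by (simp add: vnorm_power2 scalar_prod_add_distrib[of _ d] add_scalar_prod_distrib[of _ d])

text \<open>The normal equation says that the residual at \<open>y\<close> is orthogonal to the
  range of \<open>C\<close>. The resulting identity yields both minimality of \<open>y\<close> and,
  for injective \<open>C\<close>, its uniqueness.\<close>

lemma least_squares_residual:
  fixes C :: "real mat"
  assumes C: "C \<in> carrier_mat m k" and b: "b \<in> carrier_vec m"
    and y: "y \<in> carrier_vec k" and normal: "C\<^sup>T *\<^sub>v (C *\<^sub>v y - b) = 0\<^sub>v k"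
    and z: "z \<in> carrier_vec k"
  shows "(vnorm (C *\<^sub>v z - b))\<^sup>2 = (vnorm (C *\<^sub>v (z - y)))\<^sup>2 + (vnorm (C *\<^sub>v y - b))\<^sup>2"
proof -
  let ?r = "C *\<^sub>v y - b"
  have r: "?r \<in> carrier_vec m" using C b y by simp
  have "?r \<bullet> (C *\<^sub>v (z - y)) = (C\<^sup>T *\<^sub>v ?r) \<bullet> (z - y)"
    by (rule transpose_vec_mult_scalar[symmetric, OF C]) (use r y z in auto)
  also have "\<dots> = 0" using normal y z by simp
  finally have "(C *\<^sub>v (z - y)) \<bullet> ?r = 0"
    using comm_scalar_prod[OF r, of "C *\<^sub>v (z - y)"] C y z by simp
  moreover have "C *\<^sub>v (z - y) + ?r = C *\<^sub>v z - b"
    using C b y z by (subst mult_minus_distrib_mat_vec[OF C z y]) (intro eq_vecI, auto)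
  ultimately show ?thesis
    using pythagoras[of "C *\<^sub>v (z - y)" m ?r] C y z r by simp
qed

lemma pow_mat_carrier: "M \<in> carrier_mat n n \<Longrightarrow> M ^\<^sub>m i \<in> carrier_mat n n"
  by (intro carrier_matI) auto

text \<open>Powers are defined with the new factor on the right, whereas the Krylov recursion
  applies the matrix on the left.\<close>

lemma pow_mat_mult_commute: "M \<in> carrier_mat n n \<Longrightarrow> M ^\<^sub>m i * M = M * M ^\<^sub>m i"
  for M :: "'a :: semiring_1 mat"
proof (induction i)
  case (Suc i)
  thus ?case using assoc_mult_mat[OF Suc.prems pow_mat_carrier[OF Suc.prems, of i] Suc.prems] by simp
qed simp

section \<open>Golub-Kahan bidiagonalization\<close>

locale bidiagonalization =
  fixes A :: "real mat" and b :: "real vec" and m n :: nat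
  assumes A: "A \<in> carrier_mat m n" and b: "b \<in> carrier_vec m"
begin

abbreviation "\<alpha> \<equiv> gk_alpha A b"
abbreviation "\<beta> \<equiv> gk_beta A b"
abbreviation "p \<equiv> gk_p A b"
abbreviation "q \<equiv> gk_q A b"

lemma At: "A\<^sup>T \<in> carrier_mat n m"
  using A by simp

lemma golub_kahan_carrier:
  "case golub_kahan A b j of (_, _, u, v) \<Rightarrow> u \<in> carrier_vec m \<and> v \<in> carrier_vec n"
  by (induction j) (use A b in \<open>auto simp: Let_def split: prod.splits\<close>)

lemma p_carrier [simp]: "p j \<in> carrier_vec m"
  using golub_kahan_carrier[of "j - 1"] by (auto simp: gk_p_def split: prod.splits)

lemma q_carrier [simp]: "q j \<in> carrier_vec n"
  using golub_kahan_carrier[of j] by (auto simp: gk_q_def split: prod.splits)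

lemma p_dim [simp]: "dim_vec (p j) = m"
  using p_carrier by (rule carrier_vecD)

lemma q_dim [simp]: "dim_vec (q j) = n"
  using q_carrier by (rule carrier_vecD)

lemma q_0: "q 0 = 0\<^sub>v n"
  using A by (simp add: gk_q_def)

lemma beta_1: "\<beta> (Suc 0) = vnorm b"
  by (simp add: gk_beta_def)

lemma p_1: "p (Suc 0) = (1 / \<beta> (Suc 0)) \<cdot>\<^sub>v b"
  by (simp add: gk_beta_def gk_p_def)

lemma alpha_Suc: "\<alpha> (Suc j) = vnorm (A\<^sup>T *\<^sub>v p (Suc j) - \<beta> (Suc j) \<cdot>\<^sub>v q j)"
  by (simp add: gk_alpha_def gk_beta_def gk_p_def gk_q_def Let_def split: prod.splits)

lemma q_Suc: "q (Suc j) = (1 / \<alpha> (Suc j)) \<cdot>\<^sub>v (A\<^sup>T *\<^sub>v p (Suc j) - \<beta> (Suc j) \<cdot>\<^sub>v q j)"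
  unfolding alpha_Suc by (simp add: gk_beta_def gk_p_def gk_q_def Let_def split: prod.splits)

lemma beta_Suc: "\<beta> (Suc (Suc j)) = vnorm (A *\<^sub>v q (Suc j) - \<alpha> (Suc j) \<cdot>\<^sub>v p (Suc j))"
  by (simp add: gk_alpha_def gk_beta_def gk_p_def gk_q_def Let_def split: prod.splits)

lemma p_Suc:
  "p (Suc (Suc j)) = (1 / \<beta> (Suc (Suc j))) \<cdot>\<^sub>v (A *\<^sub>v q (Suc j) - \<alpha> (Suc j) \<cdot>\<^sub>v p (Suc j))"
  unfolding beta_Suc by (simp add: gk_alpha_def gk_p_def gk_q_def Let_def split: prod.splits)

lemma beta_p_1: "\<beta> (Suc 0) \<cdot>\<^sub>v p (Suc 0) = b"
  unfolding p_1 beta_1 by (rule smult_normalise)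

lemma At_p: "A\<^sup>T *\<^sub>v p (Suc j) = \<alpha> (Suc j) \<cdot>\<^sub>v q (Suc j) + \<beta> (Suc j) \<cdot>\<^sub>v q j"
proof -
  let ?r = "A\<^sup>T *\<^sub>v p (Suc j) - \<beta> (Suc j) \<cdot>\<^sub>v q j"
  have "\<alpha> (Suc j) \<cdot>\<^sub>v q (Suc j) = ?r"
    unfolding q_Suc by (subst (1 2) alpha_Suc) (rule smult_normalise)
  moreover have "A\<^sup>T *\<^sub>v p (Suc j) = ?r + \<beta> (Suc j) \<cdot>\<^sub>v q j"
    using A by (intro eq_vecI) auto
  ultimately show ?thesis by simp
qed

lemma A_q: "A *\<^sub>v q (Suc j) = \<alpha> (Suc j) \<cdot>\<^sub>v p (Suc j) + \<beta> (Suc (Suc j)) \<cdot>\<^sub>v p (Suc (Suc j))"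
proof -
  let ?z = "A *\<^sub>v q (Suc j) - \<alpha> (Suc j) \<cdot>\<^sub>v p (Suc j)"
  have "\<beta> (Suc (Suc j)) \<cdot>\<^sub>v p (Suc (Suc j)) = ?z"
    unfolding p_Suc by (subst (1 2) beta_Suc) (rule smult_normalise)
  moreover have "A *\<^sub>v q (Suc j) = \<alpha> (Suc j) \<cdot>\<^sub>v p (Suc j) + ?z"
    using A by (intro eq_vecI) auto
  ultimately show ?thesis by simp
qed

lemma p_norm: "\<beta> (Suc j) \<noteq> 0 \<Longrightarrow> p (Suc j) \<bullet> p (Suc j) = 1"
proof (cases j)
  case 0
  assume "\<beta> (Suc j) \<noteq> 0"
  thus ?thesis unfolding 0 p_1 beta_1 by (rule vnorm_normalise)
next
  case (Suc i)
  assume "\<beta> (Suc j) \<noteq> 0"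
  thus ?thesis unfolding Suc p_Suc beta_Suc by (rule vnorm_normalise)
qed

lemma q_norm: "\<alpha> (Suc j) \<noteq> 0 \<Longrightarrow> q (Suc j) \<bullet> q (Suc j) = 1"
  unfolding q_Suc alpha_Suc by (rule vnorm_normalise)

lemma adjoint: "x \<in> carrier_vec n \<Longrightarrow> y \<in> carrier_vec m \<Longrightarrow> (A *\<^sub>v x) \<bullet> y = x \<bullet> (A\<^sup>T *\<^sub>v y)"
  using transpose_vec_mult_scalar[OF A, of x y] A
  by (metis comm_scalar_prod At mult_mat_vec_carrier)

lemma scalar_At_p:
  "x \<in> carrier_vec n \<Longrightarrow>
    x \<bullet> (A\<^sup>T *\<^sub>v p (Suc j)) = \<alpha> (Suc j) * (x \<bullet> q (Suc j)) + \<beta> (Suc j) * (x \<bullet> q j)"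
  unfolding At_p by (simp add: scalar_prod_add_distrib[of _ n])

lemma scalar_A_q:
  "x \<in> carrier_vec m \<Longrightarrow>
    x \<bullet> (A *\<^sub>v q (Suc j)) = \<alpha> (Suc j) * (x \<bullet> p (Suc j)) + \<beta> (Suc (Suc j)) * (x \<bullet> p (Suc (Suc j)))"
  unfolding A_q by (simp add: scalar_prod_add_distrib[of _ m])

lemma p_comm: "p i \<bullet> p j = p j \<bullet> p i"
  by (rule comm_scalar_prod[of _ m]) auto

lemma q_comm: "q i \<bullet> q j = q j \<bullet> q i"
  by (rule comm_scalar_prod[of _ n]) auto

lemma p_A_q_eq: "p (Suc i) \<bullet> (A *\<^sub>v q (Suc j)) = q (Suc j) \<bullet> (A\<^sup>T *\<^sub>v p (Suc i))"
  using adjoint[of "q (Suc j)" "p (Suc i)"] comm_scalar_prod[of "p (Suc i)" m "A *\<^sub>v q (Suc j)"] A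
  by simp

text \<open>The number \<open>p (Suc j) . A q (Suc i)\<close> is expanded once by
  \<open>At_p\<close> and once by \<open>A_q\<close>. The two \<open>\<beta>\<close> terms agree:
  both vanish unless \<open>Suc i = j\<close>, and then both equal \<open>\<beta> (Suc j)\<close>.
  What is left is \<open>\<alpha> (Suc j)\<close> times the wanted product.\<close>

lemma q_orthogonal_step:
  assumes p: "\<And>i i'. i \<le> j \<Longrightarrow> i' \<le> j \<Longrightarrow> p (Suc i) \<bullet> p (Suc i') = (if i = i' then 1 else 0)"
    and q: "\<And>i i'. i < j \<Longrightarrow> i' < j \<Longrightarrow> q (Suc i) \<bullet> q (Suc i') = (if i = i' then 1 else 0)"
    and nz: "\<alpha> (Suc j) \<noteq> 0" and i: "i < j"
  shows "q (Suc i) \<bullet> q (Suc j) = 0"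
proof -
  obtain l where l: "j = Suc l" using i by (cases j) auto
  have "\<alpha> (Suc j) * (q (Suc i) \<bullet> q (Suc j)) + \<beta> (Suc j) * (q (Suc i) \<bullet> q j) =
      \<alpha> (Suc i) * (p (Suc j) \<bullet> p (Suc i)) + \<beta> (Suc (Suc i)) * (p (Suc j) \<bullet> p (Suc (Suc i)))"
    using p_A_q_eq[of j i] by (simp add: scalar_At_p scalar_A_q)
  moreover have "\<beta> (Suc j) * (q (Suc i) \<bullet> q j) = \<beta> (Suc (Suc i)) * (p (Suc j) \<bullet> p (Suc (Suc i)))"
    using p[of j "Suc i"] q[of i l] i l by auto
  ultimately show ?thesis using p[of j i] i nz by simp
qed

text \<open>The same double expansion, now of \<open>p (Suc i) . A q (Suc j)\<close>. Here the
  \<open>\<alpha>\<close> terms agree, being nonzero only for \<open>i = j\<close>, and the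
  convention \<open>q 0 = 0\<close> covers \<open>i = 0\<close>.\<close>

lemma p_orthogonal_step:
  assumes p: "\<And>i i'. i \<le> j \<Longrightarrow> i' \<le> j \<Longrightarrow> p (Suc i) \<bullet> p (Suc i') = (if i = i' then 1 else 0)"
    and q: "\<And>i i'. i \<le> j \<Longrightarrow> i' \<le> j \<Longrightarrow> q (Suc i) \<bullet> q (Suc i') = (if i = i' then 1 else 0)"
    and nz: "\<beta> (Suc (Suc j)) \<noteq> 0" and i: "i \<le> j"
  shows "p (Suc i) \<bullet> p (Suc (Suc j)) = 0"
proof -
  have "\<alpha> (Suc j) * (p (Suc i) \<bullet> p (Suc j)) + \<beta> (Suc (Suc j)) * (p (Suc i) \<bullet> p (Suc (Suc j))) =
      \<alpha> (Suc i) * (q (Suc j) \<bullet> q (Suc i)) + \<beta> (Suc i) * (q (Suc j) \<bullet> q i)"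
    using p_A_q_eq[of i j] by (simp add: scalar_At_p scalar_A_q)
  moreover have "q (Suc j) \<bullet> q i = 0"
    using q[of j "i - 1"] i q_0 by (cases i) auto
  ultimately show ?thesis using p[of i j] q[of j i] i nz by (auto split: if_splits)
qed

text \<open>Simultaneous induction: each round first adds \<open>p (Suc N)\<close>, then
  \<open>q (Suc N)\<close>, whose orthogonality uses the enlarged family of left vectors.\<close>

lemma orthonormal_vectors:
  assumes "\<And>i. i < N \<Longrightarrow> \<alpha> (Suc i) \<noteq> 0" "\<And>i. i < N \<Longrightarrow> \<beta> (Suc i) \<noteq> 0"
    and "i < N" "j < N"
  shows "p (Suc i) \<bullet> p (Suc j) = (if i = j then 1 else 0) \<and>
    q (Suc i) \<bullet> q (Suc j) = (if i = j then 1 else 0)"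
  using assms
proof (induction N arbitrary: i j)
  case (Suc N)
  have IH: "p (Suc i) \<bullet> p (Suc j) = (if i = j then 1 else 0)"
    "q (Suc i) \<bullet> q (Suc j) = (if i = j then 1 else 0)" if "i < N" "j < N" for i j
    using Suc.IH[of i j] Suc.prems(1,2) that by simp_all
  have pN: "p (Suc i) \<bullet> p (Suc N) = 0" if iN: "i < N" for i
  proof -
    obtain l where l: "N = Suc l" using iN by (cases N) auto
    show ?thesis unfolding l
      by (rule p_orthogonal_step) (use IH Suc.prems(2)[of N] iN l in auto)
  qed
  have p: "p (Suc i) \<bullet> p (Suc j) = (if i = j then 1 else 0)" if "i \<le> N" "j \<le> N" for i j
    using that IH(1)[of i j] pN[of i] pN[of j] p_norm[of N] Suc.prems(2)[of N] p_comm[of "Suc i" "Suc j"]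
    by (cases "i = N"; cases "j = N") auto
  have qN: "q (Suc i) \<bullet> q (Suc N) = 0" if "i < N" for i
    by (rule q_orthogonal_step) (use p IH Suc.prems(1)[of N] that in auto)
  have "q (Suc i) \<bullet> q (Suc j) = (if i = j then 1 else 0)" if "i \<le> N" "j \<le> N" for i j
    using that IH(2)[of i j] qN[of i] qN[of j] q_norm[of N] Suc.prems(1)[of N] q_comm[of "Suc i" "Suc j"]
    by (cases "i = N"; cases "j = N") auto
  with p Suc.prems(3,4) show ?case by simp
qed simp

text \<open>\<open>P\<close> has one column more than \<open>Q\<close>. At \<open>k = s\<close> the
  coefficient \<open>\<alpha> (Suc s)\<close> is out of reach of \<open>no_breakdown\<close>, so the
  last left vector is added without it.\<close>

lemma orthonormal_p_Suc:
  assumes "\<And>i. i < N \<Longrightarrow> \<alpha> (Suc i) \<noteq> 0" "\<And>i. i \<le> N \<Longrightarrow> \<beta> (Suc i) \<noteq> 0"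
    and "i \<le> N" "j \<le> N"
  shows "p (Suc i) \<bullet> p (Suc j) = (if i = j then 1 else 0)"
proof -
  have pN: "p (Suc i) \<bullet> p (Suc N) = 0" if iN: "i < N" for i
  proof -
    obtain l where l: "N = Suc l" using iN by (cases N) auto
    show ?thesis unfolding l
      by (rule p_orthogonal_step)
        (use orthonormal_vectors[of N] assms(1,2) iN l in auto)
  qed
  show ?thesis
    using assms(3,4) orthonormal_vectors[of N i j] assms(1,2) pN[of i] pN[of j] p_norm[of N]
      p_comm[of "Suc i" "Suc j"]
    by (cases "i = N"; cases "j = N") auto
qed

section \<open>Krylov spaces of \<open>A^T A\<close>\<close>

abbreviation "gram \<equiv> A\<^sup>T * A"
abbreviation "krylov_vec i \<equiv> (gram ^\<^sub>m i) *\<^sub>v (A\<^sup>T *\<^sub>v b)"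

lemma gram: "gram \<in> carrier_mat n n"
  using A by simp

lemma gram_mult: "x \<in> carrier_vec n \<Longrightarrow> gram *\<^sub>v x = A\<^sup>T *\<^sub>v (A *\<^sub>v x)"
  by (rule assoc_mult_mat_vec[OF At A])

lemma At_b: "A\<^sup>T *\<^sub>v b \<in> carrier_vec n"
  using At b by simp

lemma krylov_vec_carrier [simp]: "krylov_vec i \<in> carrier_vec n"
  using pow_mat_carrier[OF gram, of i] At_b by simp

lemma krylov_vec_0: "krylov_vec 0 = A\<^sup>T *\<^sub>v b"
  using gram At_b A by simp

lemma krylov_vec_Suc: "krylov_vec (Suc i) = gram *\<^sub>v krylov_vec i"
  unfolding pow_mat.simps(2) pow_mat_mult_commute[OF gram]
  by (rule assoc_mult_mat_vec[OF gram pow_mat_carrier[OF gram] At_b])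

lemma krylov_image: "krylov j gram (A\<^sup>T *\<^sub>v b) = vspan n (krylov_vec ` {..<j})"
  using A by (simp add: krylov_def image_def lessThan_def Bex_def conj_commute)

lemma krylov_vecs_carrier: "krylov_vec ` {..<j} \<subseteq> carrier_vec n"
  by auto

text \<open>The left vectors do not live in this space, so the induction carries
  \<open>A^T p\<close> along with \<open>q\<close>: applying \<open>A^T\<close> to the recurrence
  for \<open>p\<close> leaves only \<open>gram\<close> applied to a \<open>q\<close> and an earlier
  \<open>A^T p\<close>. A breakdown does no harm, since it produces the zero vector.\<close>

lemma vectors_in_krylov:
  "A\<^sup>T *\<^sub>v p (Suc j) \<in> vspan n (krylov_vec ` {..<Suc j}) \<and>
   q (Suc j) \<in> vspan n (krylov_vec ` {..<Suc j})"
proof -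
  let ?K = "\<lambda>j. vspan n (krylov_vec ` {..<j})"
  note S = krylov_vecs_carrier
  have mono: "?K j \<subseteq> ?K (Suc j)" for j
    by (rule vspan_subsetI[OF S subset_trans[OF _ vspan_superset[OF S]]]) auto
  have gram_K: "gram *\<^sub>v x \<in> ?K (Suc j)" if "x \<in> ?K j" for x j
  proof (rule vspan_image[OF _ S S gram _ that])
    fix y assume "y \<in> krylov_vec ` {..<j}"
    hence "gram *\<^sub>v y \<in> krylov_vec ` {..<Suc j}"
      by (auto simp: krylov_vec_Suc[symmetric] simp del: pow_mat.simps)
    thus "gram *\<^sub>v y \<in> ?K (Suc j)" using vspan_superset[OF S] by blast
  qed simp
  show ?thesis
  proof (induction j)
    case 0
    have "krylov_vec 0 \<in> ?K (Suc 0)" using vspan_superset[OF S] by blast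
    hence Ap: "A\<^sup>T *\<^sub>v p (Suc 0) \<in> ?K (Suc 0)"
      unfolding p_1 mult_mat_vec[OF At b] krylov_vec_0 by (rule vspan_smult[OF S])
    moreover have "\<beta> (Suc 0) \<cdot>\<^sub>v q 0 \<in> ?K (Suc 0)"
      unfolding q_0 by (intro vspan_smult[OF S] vspan_zero[OF S])
    ultimately have "q (Suc 0) \<in> ?K (Suc 0)"
      unfolding q_Suc using vspan_smult[OF S vspan_diff[OF S]] by blast
    with Ap show ?case ..
  next
    case (Suc j)
    have "A\<^sup>T *\<^sub>v (A *\<^sub>v q (Suc j) - \<alpha> (Suc j) \<cdot>\<^sub>v p (Suc j)) =
        gram *\<^sub>v q (Suc j) - \<alpha> (Suc j) \<cdot>\<^sub>v (A\<^sup>T *\<^sub>v p (Suc j))"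
      using mult_minus_distrib_mat_vec[OF At, of "A *\<^sub>v q (Suc j)" "\<alpha> (Suc j) \<cdot>\<^sub>v p (Suc j)"]
        mult_mat_vec[OF At, of "p (Suc j)"] A by (simp add: gram_mult)
    moreover have "A *\<^sub>v q (Suc j) - \<alpha> (Suc j) \<cdot>\<^sub>v p (Suc j) \<in> carrier_vec m"
      using A by simp
    ultimately have Ap_eq: "A\<^sup>T *\<^sub>v p (Suc (Suc j)) =
        (1 / \<beta> (Suc (Suc j))) \<cdot>\<^sub>v (gram *\<^sub>v q (Suc j) - \<alpha> (Suc j) \<cdot>\<^sub>v (A\<^sup>T *\<^sub>v p (Suc j)))"
      unfolding p_Suc by (simp add: mult_mat_vec[OF At])
    have Ap: "A\<^sup>T *\<^sub>v p (Suc (Suc j)) \<in> ?K (Suc (Suc j))"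
      unfolding Ap_eq using Suc mono gram_K
      by (intro vspan_smult[OF S] vspan_diff[OF S]) auto
    thus ?case unfolding q_Suc[of "Suc j"]
      using Suc mono by (intro conjI vspan_smult[OF S] vspan_diff[OF S]) auto
  qed
qed

text \<open>One inclusion is \<open>vectors_in_krylov\<close>. For the other, each application of
  \<open>gram\<close> costs at most one further \<open>q\<close>, and \<open>A^T b\<close> is a
  multiple of \<open>q 1\<close>.\<close>

lemma krylov_eq_vspan_q:
  "krylov k gram (A\<^sup>T *\<^sub>v b) = vspan n ((\<lambda>i. q (Suc i)) ` {..<k})"
  unfolding krylov_image
proof
  let ?K = "\<lambda>j. vspan n (krylov_vec ` {..<j})"
  let ?T = "\<lambda>k. (\<lambda>i. q (Suc i)) ` {..<k}"
  note S = krylov_vecs_carrier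
  have T: "?T j \<subseteq> carrier_vec n" for j by auto
  have "?K (Suc i) \<subseteq> ?K k" if "i < k" for i
    using that by (intro vspan_subsetI[OF S subset_trans[OF _ vspan_superset[OF S]]]) auto
  thus "vspan n (?T k) \<subseteq> ?K k"
    using vectors_in_krylov by (intro vspan_subsetI[OF S]) blast
  have q_T: "q j \<in> vspan n (?T k)" if "j \<le> k" for j k
    using vspan_superset[OF T[of k]] vspan_zero[OF T] that by (cases j) (auto simp: q_0)
  \<comment> \<open>\<open>gram\<close> acts tridiagonally: by \<open>A_q\<close> and
    \<open>At_p\<close> it sends \<open>q (Suc j)\<close> to a combination of \<open>q j\<close>,
    \<open>q (Suc j)\<close> and \<open>q (Suc (Suc j))\<close>.\<close>
  have gram_T: "gram *\<^sub>v x \<in> vspan n (?T (Suc k))" if "x \<in> vspan n (?T k)" for x k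
  proof (rule vspan_image[OF _ T T gram _ that])
    fix y assume "y \<in> ?T k"
    then obtain j where j: "j < k" "y = q (Suc j)" by auto
    have "gram *\<^sub>v y = A\<^sup>T *\<^sub>v (A *\<^sub>v q (Suc j))"
      unfolding j(2) by (rule gram_mult) simp
    also have "\<dots> = \<alpha> (Suc j) \<cdot>\<^sub>v (A\<^sup>T *\<^sub>v p (Suc j)) + \<beta> (Suc (Suc j)) \<cdot>\<^sub>v (A\<^sup>T *\<^sub>v p (Suc (Suc j)))"
      unfolding A_q by (simp add: mult_add_distrib_mat_vec[OF At] mult_mat_vec[OF At])
    also have "\<dots> \<in> vspan n (?T (Suc k))"
      unfolding At_p using j(1)
      by (intro vspan_add[OF T] vspan_smult[OF T] q_T) auto
    finally show "gram *\<^sub>v y \<in> vspan n (?T (Suc k))" .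
  qed simp
  have vec_T: "krylov_vec i \<in> vspan n (?T (Suc i))" for i
  proof (induction i)
    case 0
    have "krylov_vec 0 = \<beta> (Suc 0) \<cdot>\<^sub>v (A\<^sup>T *\<^sub>v p (Suc 0))"
      unfolding krylov_vec_0 using mult_mat_vec[OF At, of "p (Suc 0)" "\<beta> (Suc 0)"] beta_p_1 by simp
    also have "\<dots> \<in> vspan n (?T (Suc 0))"
      unfolding At_p by (intro vspan_add[OF T] vspan_smult[OF T] q_T) auto
    finally show ?case .
  next
    case (Suc i)
    show ?case unfolding krylov_vec_Suc by (rule gram_T[OF Suc])
  qed
  have "vspan n (?T (Suc i)) \<subseteq> vspan n (?T k)" if "i < k" for i
    using that by (intro vspan_subsetI[OF T subset_trans[OF _ vspan_superset[OF T]]]) auto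
  thus "?K k \<subseteq> vspan n (?T k)"
    using vec_T by (intro vspan_subsetI[OF T]) blast
qed

end

section \<open>Least squares through an orthonormal basis\<close>

lemma orthonormal_columns_mat_of_cols:
  assumes ws: "set ws \<subseteq> carrier_vec d"
    and orth: "\<And>i j. i < length ws \<Longrightarrow> j < length ws \<Longrightarrow> ws ! i \<bullet> ws ! j = (if i = j then 1 else 0)"
  shows "orthonormal_columns (mat_of_cols d ws)"
  unfolding orthonormal_columns_def
proof (rule eq_matI)
  fix i j
  assume "i < dim_row (1\<^sub>m (dim_col (mat_of_cols d ws)))" "j < dim_col (1\<^sub>m (dim_col (mat_of_cols d ws)))"
  hence ij: "i < length ws" "j < length ws" by simp_all
  moreover have "ws ! i \<in> carrier_vec d" "ws ! j \<in> carrier_vec d"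
    using ij ws by auto
  ultimately show "((mat_of_cols d ws)\<^sup>T * mat_of_cols d ws) $$ (i, j) = 1\<^sub>m (dim_col (mat_of_cols d ws)) $$ (i, j)"
    using orth by simp
qed simp_all

lemma orthonormal_columns_isometry:
  assumes X: "X \<in> carrier_mat d k" "orthonormal_columns X" and y: "y \<in> carrier_vec k"
  shows "X\<^sup>T *\<^sub>v (X *\<^sub>v y) = y" and "vnorm (X *\<^sub>v y) = vnorm y"
proof -
  have XX: "X\<^sup>T * X = 1\<^sub>m k"
    using X by (simp add: orthonormal_columns_def)
  have "X\<^sup>T *\<^sub>v (X *\<^sub>v y) = (X\<^sup>T * X) *\<^sub>v y"
    by (rule assoc_mult_mat_vec[symmetric]) (use X y in auto)
  thus *: "X\<^sup>T *\<^sub>v (X *\<^sub>v y) = y"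
    using y unfolding XX by simp
  have "(X *\<^sub>v y) \<bullet> (X *\<^sub>v y) = (X\<^sup>T *\<^sub>v (X *\<^sub>v y)) \<bullet> y"
    by (rule transpose_vec_mult_scalar[symmetric, OF X(1) y]) (use X y in auto)
  thus "vnorm (X *\<^sub>v y) = vnorm y"
    unfolding * by (simp add: vnorm_def)
qed

lemma vec_eq_if_diff_eq_0:
  assumes "x \<in> carrier_vec d" "y \<in> carrier_vec d" "x - y = 0\<^sub>v d"
  shows "x = (y :: 'a :: ab_group_add vec)"
proof (rule eq_vecI)
  fix i assume i: "i < dim_vec y"
  have "(x - y) $ i = 0\<^sub>v d $ i" by (simp only: assms(3))
  thus "x $ i = y $ i" using i assms(2) by simp
qed (use assms in simp)

text \<open>To be used with \<open>C = P * B\<close>. Fixing the solution of the normal equation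
  makes it the common reference point for the problems in the coefficients, in the Krylov space and
  in the full space.\<close>

locale least_squares =
  fixes C :: "real mat" and b y\<^sub>0 :: "real vec" and m k :: nat
  assumes C: "C \<in> carrier_mat m k" and b: "b \<in> carrier_vec m" and y\<^sub>0: "y\<^sub>0 \<in> carrier_vec k"
    and injective: "\<And>y. y \<in> carrier_vec k \<Longrightarrow> C *\<^sub>v y = 0\<^sub>v m \<Longrightarrow> y = 0\<^sub>v k"
    and normal_equation: "C\<^sup>T *\<^sub>v (C *\<^sub>v y\<^sub>0 - b) = 0\<^sub>v k"
begin

lemma residual_le: "y \<in> carrier_vec k \<Longrightarrow> vnorm (C *\<^sub>v y\<^sub>0 - b) \<le> vnorm (C *\<^sub>v y - b)"
  using least_squares_residual[OF C b y\<^sub>0 normal_equation, of y]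
  by - (rule power2_le_imp_le[OF _ vnorm_nonneg], simp)

lemma residual_less:
  assumes y: "y \<in> carrier_vec k" "y \<noteq> y\<^sub>0"
  shows "vnorm (C *\<^sub>v y\<^sub>0 - b) < vnorm (C *\<^sub>v y - b)"
proof -
  have "C *\<^sub>v (y - y\<^sub>0) \<noteq> 0\<^sub>v m"
  proof
    assume "C *\<^sub>v (y - y\<^sub>0) = 0\<^sub>v m"
    hence d: "y - y\<^sub>0 = 0\<^sub>v k" using injective y y\<^sub>0 by simp
    hence "y = y\<^sub>0" using vec_eq_if_diff_eq_0 y y\<^sub>0 by blast
    with y(2) show False by contradiction
  qed
  hence "vnorm (C *\<^sub>v (y - y\<^sub>0)) \<noteq> 0"
    using vnorm_eq_0_iff[of "C *\<^sub>v (y - y\<^sub>0)" m] C y y\<^sub>0 by simp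
  thus ?thesis
    using least_squares_residual[OF C b y\<^sub>0 normal_equation y(1)]
    by - (rule power2_less_imp_less[OF _ vnorm_nonneg], simp)
qed

text \<open>If the objective at \<open>x\<close> depends only on the coefficients
  \<open>g x\<close>, and \<open>g\<close> reaches every coefficient vector, then the minimizers
  form the fibre of \<open>g\<close> over the unique best coefficients. It serves three times:
  \<open>g\<close> is \<open>Q^T\<close> on the full space, \<open>Q^T\<close> on the range of
  \<open>Q\<close>, and the identity.\<close>

lemma is_arg_min_residual_iff:
  assumes range: "g ` X = carrier_vec k" and f: "\<And>x. x \<in> X \<Longrightarrow> f x = vnorm (C *\<^sub>v g x - b)"
  shows "is_arg_min f (\<lambda>x. x \<in> X) x \<longleftrightarrow> x \<in> X \<and> g x = y\<^sub>0"
proof -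
  have g: "g x \<in> carrier_vec k" if "x \<in> X" for x
    using that range by blast
  obtain x\<^sub>0 where x\<^sub>0: "x\<^sub>0 \<in> X" "g x\<^sub>0 = y\<^sub>0"
    using y\<^sub>0 range by (metis imageE)
  show ?thesis
  proof
    assume min: "is_arg_min f (\<lambda>x. x \<in> X) x"
    hence x: "x \<in> X" by (simp add: is_arg_min_def)
    have "\<not> f x\<^sub>0 < f x" using min x\<^sub>0(1) by (auto simp: is_arg_min_def)
    thus "x \<in> X \<and> g x = y\<^sub>0"
      using x x\<^sub>0 f[of x] f[of x\<^sub>0] residual_less[OF g[OF x]] by auto
  next
    assume "x \<in> X \<and> g x = y\<^sub>0"
    thus "is_arg_min f (\<lambda>x. x \<in> X) x"
      using residual_le[OF g] f by (auto simp: is_arg_min_def not_less)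
  qed
qed

context
  fixes Q :: "real mat" and n :: nat
  assumes Q: "Q \<in> carrier_mat n k" "orthonormal_columns Q"
begin

lemma ls_solutions_projected: "ls_solutions (C * Q\<^sup>T) b = {x \<in> carrier_vec n. Q\<^sup>T *\<^sub>v x = y\<^sub>0}"
proof -
  have "(\<lambda>x. Q\<^sup>T *\<^sub>v x) ` carrier_vec n = carrier_vec k"
  proof
    show "carrier_vec k \<subseteq> (\<lambda>x. Q\<^sup>T *\<^sub>v x) ` carrier_vec n"
    proof
      fix y :: "real vec" assume y: "y \<in> carrier_vec k"
      have "y = Q\<^sup>T *\<^sub>v (Q *\<^sub>v y)" "Q *\<^sub>v y \<in> carrier_vec n"
        using orthonormal_columns_isometry(1)[OF Q y] Q y by auto
      thus "y \<in> (\<lambda>x. Q\<^sup>T *\<^sub>v x) ` carrier_vec n" by blast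
    qed
  qed (use Q in auto)
  moreover have "vnorm (C * Q\<^sup>T *\<^sub>v x - b) = vnorm (C *\<^sub>v (Q\<^sup>T *\<^sub>v x) - b)" if "x \<in> carrier_vec n" for x
    using C Q that by (subst assoc_mult_mat_vec[of _ m k _ n]) auto
  moreover have "dim_col (C * Q\<^sup>T) = n" using Q by simp
  ultimately show ?thesis
    using is_arg_min_residual_iff[of "\<lambda>x. Q\<^sup>T *\<^sub>v x" "carrier_vec n" "\<lambda>x. vnorm (C * Q\<^sup>T *\<^sub>v x - b)"]
    by (simp add: ls_solutions_def)
qed

text \<open>Two least squares solutions differ by a kernel vector of \<open>Q^T\<close>, which is
  orthogonal to the range of \<open>Q\<close>. By Pythagoras the solution inside that range is
  strictly shorter than any other.\<close>

lemma min_norm_ls_solution_iff: "min_norm_ls_solution (C * Q\<^sup>T) b x \<longleftrightarrow> x = Q *\<^sub>v y\<^sub>0"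
proof -
  let ?x = "Q *\<^sub>v y\<^sub>0"
  have x: "?x \<in> carrier_vec n" "Q\<^sup>T *\<^sub>v ?x = y\<^sub>0"
    using Q y\<^sub>0 orthonormal_columns_isometry(1)[OF Q y\<^sub>0] by auto
  have split: "(vnorm z)\<^sup>2 = (vnorm ?x)\<^sup>2 + (vnorm (z - ?x))\<^sup>2"
    if z: "z \<in> carrier_vec n" "Q\<^sup>T *\<^sub>v z = y\<^sub>0" for z
  proof -
    have "(z - ?x) \<bullet> ?x = (Q\<^sup>T *\<^sub>v (z - ?x)) \<bullet> y\<^sub>0"
      by (rule transpose_vec_mult_scalar[symmetric, OF Q(1) y\<^sub>0]) (use x z in auto)
    also have "Q\<^sup>T *\<^sub>v (z - ?x) = y\<^sub>0 - y\<^sub>0"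
      using Q z x by (subst mult_minus_distrib_mat_vec[of _ k n]) auto
    also have "(y\<^sub>0 - y\<^sub>0) \<bullet> y\<^sub>0 = 0"
      using y\<^sub>0 by simp
    finally have "?x \<bullet> (z - ?x) = 0"
      using comm_scalar_prod[of ?x n "z - ?x"] x z by simp
    moreover have "?x + (z - ?x) = z"
      using carrier_vecD[OF x(1)] carrier_vecD[OF z(1)] Q by (intro eq_vecI) simp_all
    ultimately show ?thesis
      using pythagoras[of ?x n "z - ?x"] x z by simp
  qed
  have le: "vnorm ?x \<le> vnorm z" if "z \<in> carrier_vec n" "Q\<^sup>T *\<^sub>v z = y\<^sub>0" for z
    using split[OF that] by - (rule power2_le_imp_le[OF _ vnorm_nonneg], simp)
  have eq: "z = ?x" if z: "z \<in> carrier_vec n" "Q\<^sup>T *\<^sub>v z = y\<^sub>0" and "vnorm z \<le> vnorm ?x" for z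
  proof -
    have "vnorm z = vnorm ?x" using le[OF z] that(3) by simp
    hence "vnorm (z - ?x) = 0" using split[OF z] by simp
    hence d: "z - ?x = 0\<^sub>v n" using vnorm_eq_0_iff[of "z - ?x" n] z x by simp
    thus "z = ?x" using vec_eq_if_diff_eq_0 z x by blast
  qed
  show ?thesis
  proof
    assume "min_norm_ls_solution (C * Q\<^sup>T) b x"
    hence "x \<in> carrier_vec n" "Q\<^sup>T *\<^sub>v x = y\<^sub>0" "\<not> vnorm ?x < vnorm x"
      using x unfolding min_norm_ls_solution_def ls_solutions_projected is_arg_min_def by auto
    thus "x = ?x" by (intro eq) auto
  next
    assume "x = ?x"
    thus "min_norm_ls_solution (C * Q\<^sup>T) b x"
      using x le unfolding min_norm_ls_solution_def ls_solutions_projected is_arg_min_def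
      by (auto simp: not_less)
  qed
qed

text \<open>On the range of \<open>Q\<close> one has \<open>x = Q (Q^T x)\<close>, hence
  \<open>A x = C (Q^T x)\<close>. Uniqueness of the minimizer is what identifies the value of the
  choice operator.\<close>

lemma arg_min_on_range:
  assumes A: "A \<in> carrier_mat m n" and AQ: "A * Q = C"
  shows "arg_min_on (\<lambda>x. vnorm (A *\<^sub>v x - b)) {Q *\<^sub>v y |y. y \<in> carrier_vec k} = Q *\<^sub>v y\<^sub>0"
proof -
  let ?X = "{Q *\<^sub>v y |y. y \<in> carrier_vec k}"
  have iff: "is_arg_min (\<lambda>x. vnorm (A *\<^sub>v x - b)) (\<lambda>x. x \<in> ?X) x \<longleftrightarrow> x \<in> ?X \<and> Q\<^sup>T *\<^sub>v x = y\<^sub>0" for x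
  proof (rule is_arg_min_residual_iff)
    show "(\<lambda>x. Q\<^sup>T *\<^sub>v x) ` ?X = carrier_vec k"
      using orthonormal_columns_isometry(1)[OF Q] by (force simp: image_iff)
    fix x assume "x \<in> ?X"
    then obtain y where y: "y \<in> carrier_vec k" "x = Q *\<^sub>v y" by blast
    have "A *\<^sub>v x = C *\<^sub>v y" unfolding y(2) AQ[symmetric] by (rule assoc_mult_mat_vec[symmetric, OF A Q(1) y(1)])
    moreover have "Q\<^sup>T *\<^sub>v x = y" unfolding y(2) by (rule orthonormal_columns_isometry(1)[OF Q y(1)])
    ultimately show "vnorm (A *\<^sub>v x - b) = vnorm (C *\<^sub>v (Q\<^sup>T *\<^sub>v x) - b)" by simp
  qed
  show ?thesis
    unfolding arg_min_on_def arg_min_def iff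
    by (rule some_equality) (use y\<^sub>0 orthonormal_columns_isometry(1)[OF Q] in auto)
qed

end

end

section \<open>Absence of breakdown\<close>

lemma poly_zero_if_many_roots:
  fixes f :: "real poly" and t :: "nat \<Rightarrow> real"
  assumes inj: "inj_on t {1..s}" and roots: "\<And>i. i \<in> {1..s} \<Longrightarrow> poly f (t i) = 0"
    and deg: "degree f < s"
  shows "f = 0"
proof (rule ccontr)
  assume f: "f \<noteq> 0"
  have "s = card (t ` {1..s})" using card_image[OF inj] by simp
  also have "\<dots> \<le> card {x. poly f x = 0}"
    by (rule card_mono[OF poly_roots_finite[OF f]]) (use roots in auto)
  also have "\<dots> \<le> degree f" by (rule card_poly_roots_bound[OF f])
  finally show False using deg by simp
qed

text \<open>Isolates what the iteration sees of the decomposition: one left singular direction for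
  each distinct singular value, each met by \<open>b\<close>, and together carrying all of
  \<open>A^T b\<close>.\<close>

locale spectral_bidiagonalization = bidiagonalization +
  fixes s :: nat and \<sigma> :: "nat \<Rightarrow> real" and u :: "nat \<Rightarrow> real vec"
  assumes \<sigma>_pos: "\<And>i. i \<in> {1..s} \<Longrightarrow> \<sigma> i > 0"
    and \<sigma>_inj: "inj_on \<sigma> {1..s}"
    and u: "\<And>i. i \<in> {1..s} \<Longrightarrow> u i \<in> carrier_vec m"
    and eigenvector: "\<And>i. i \<in> {1..s} \<Longrightarrow> A *\<^sub>v (A\<^sup>T *\<^sub>v u i) = (\<sigma> i)\<^sup>2 \<cdot>\<^sub>v u i"
    and u_b: "\<And>i. i \<in> {1..s} \<Longrightarrow> u i \<bullet> b \<noteq> 0"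
    and At_b_expansion: "\<And>t. t < n \<Longrightarrow> (A\<^sup>T *\<^sub>v b) $ t = (\<Sum>i\<in>{1..s}. (u i \<bullet> b) * (A\<^sup>T *\<^sub>v u i) $ t)"
begin

lemma squares_inj: "inj_on (\<lambda>i. (\<sigma> i)\<^sup>2) {1..s}"
  using \<sigma>_inj \<sigma>_pos unfolding inj_on_def
  by (metis less_imp_le power2_eq_imp_eq)

lemma scalar_At_u:
  assumes i: "i \<in> {1..s}"
  shows "x \<in> carrier_vec m \<Longrightarrow> (A\<^sup>T *\<^sub>v u i) \<bullet> (A\<^sup>T *\<^sub>v x) = (\<sigma> i)\<^sup>2 * (u i \<bullet> x)"
    and "x \<in> carrier_vec n \<Longrightarrow> u i \<bullet> (A *\<^sub>v x) = (A\<^sup>T *\<^sub>v u i) \<bullet> x"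
proof -
  have Au: "A\<^sup>T *\<^sub>v u i \<in> carrier_vec n" using At u[OF i] by simp
  show "x \<in> carrier_vec m \<Longrightarrow> (A\<^sup>T *\<^sub>v u i) \<bullet> (A\<^sup>T *\<^sub>v x) = (\<sigma> i)\<^sup>2 * (u i \<bullet> x)"
    using adjoint[OF Au, of x] u[OF i] by (simp add: eigenvector[OF i])
  show "x \<in> carrier_vec n \<Longrightarrow> u i \<bullet> (A *\<^sub>v x) = (A\<^sup>T *\<^sub>v u i) \<bullet> x"
    using transpose_vec_mult_scalar[OF A _ u[OF i]] by simp
qed

text \<open>In the eigendirections of \<open>A A\<^sup>T\<close> and \<open>A\<^sup>T A\<close> the vectors \<open>p\<^sub>j\<^sub>+\<^sub>1\<close> and \<open>q\<^sub>j\<^sub>+\<^sub>1\<close> are given by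
  polynomials of degree \<open>j\<close> in the eigenvalues. A breakdown at \<open>j < s\<close> would make a nonzero
  polynomial of degree at most \<open>j\<close> vanish at the \<open>s\<close> distinct eigenvalues.\<close>

definition represents_p :: "nat \<Rightarrow> real poly \<Rightarrow> bool" where
  "represents_p j \<psi> \<longleftrightarrow> (\<forall>i\<in>{1..s}. u i \<bullet> p j = (u i \<bullet> b) * poly \<psi> ((\<sigma> i)\<^sup>2))"

text \<open>The factor \<open>(\<sigma> i)^2\<close> arises because \<open>q\<close> is built from
  vectors \<open>A^T p\<close>, and pairing these with \<open>A^T u i\<close> brings out the
  eigenvalue. Splitting it off keeps the degree of the polynomial for \<open>q (Suc j)\<close> at
  \<open>j\<close>.\<close>

definition represents_q :: "nat \<Rightarrow> real poly \<Rightarrow> bool" where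
  "represents_q j \<phi> \<longleftrightarrow>
    (\<forall>i\<in>{1..s}. (A\<^sup>T *\<^sub>v u i) \<bullet> q j = (u i \<bullet> b) * (\<sigma> i)\<^sup>2 * poly \<phi> ((\<sigma> i)\<^sup>2))"

text \<open>The zero polynomial has \<open>degree\<close> 0, so it must be excluded explicitly for
  the root count to apply when \<open>j = 0\<close>.\<close>

definition exact_degree :: "real poly \<Rightarrow> nat \<Rightarrow> bool" where
  "exact_degree f j \<longleftrightarrow> f \<noteq> 0 \<and> degree f = j"

text \<open>The recurrence subtracts a polynomial of lower degree from \<open>\<psi>\<close>, so the
  leading coefficient of \<open>\<psi>\<close> survives. The alternative \<open>\<phi> = 0\<close>
  admits the starting vector \<open>q 0 = 0\<close>.\<close>

lemma alpha_step:
  assumes p: "represents_p (Suc j) \<psi>" "exact_degree \<psi> j"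
    and q: "represents_q j \<phi>" "\<phi> = 0 \<or> degree \<phi> < j" and j: "j < s"
  shows "\<alpha> (Suc j) \<noteq> 0 \<and> (\<exists>\<phi>'. represents_q (Suc j) \<phi>' \<and> exact_degree \<phi>' j)"
proof -
  let ?f = "\<psi> - Polynomial.smult (\<beta> (Suc j)) \<phi>"
  have deg: "?f \<noteq> 0" "degree ?f = j"
  proof -
    have "coeff (Polynomial.smult (\<beta> (Suc j)) \<phi>) j = 0"
      using q(2) by (auto simp: coeff_eq_0)
    hence lead: "coeff ?f j = lead_coeff \<psi>"
      using p(2) by (simp add: exact_degree_def)
    hence "coeff ?f j \<noteq> 0" using p(2) by (auto simp: exact_degree_def)
    moreover have "degree ?f \<le> j"
      using q(2) p(2) by (intro degree_diff_le) (auto simp: exact_degree_def intro: order_trans[OF degree_smult_le])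
    ultimately show "?f \<noteq> 0" "degree ?f = j"
      using le_degree[of ?f "j"] coeff_0[of "j"] by (metis, metis antisym)
  qed
  have eq: "\<alpha> (Suc j) * ((A\<^sup>T *\<^sub>v u i) \<bullet> q (Suc j)) = (u i \<bullet> b) * (\<sigma> i)\<^sup>2 * poly ?f ((\<sigma> i)\<^sup>2)"
    if i: "i \<in> {1..s}" for i
    using scalar_At_u(1)[OF i, of "p (Suc j)"] scalar_At_p[of "A\<^sup>T *\<^sub>v u i" j] At u[OF i] p(1) q(1) i
    by (simp add: represents_p_def represents_q_def algebra_simps)
  have nz: "\<alpha> (Suc j) \<noteq> 0"
  proof
    assume "\<alpha> (Suc j) = 0"
    hence "poly ?f ((\<sigma> i)\<^sup>2) = 0" if "i \<in> {1..s}" for i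
      using eq[OF that] u_b[OF that] \<sigma>_pos[OF that] by simp
    hence "?f = 0" by (rule poly_zero_if_many_roots[OF squares_inj]) (use deg(2) j in simp_all)
    with deg(1) show False by contradiction
  qed
  moreover have "represents_q (Suc j) (Polynomial.smult (1 / \<alpha> (Suc j)) ?f)"
    using eq nz unfolding represents_q_def by (auto simp: field_simps)
  moreover have "exact_degree (Polynomial.smult (1 / \<alpha> (Suc j)) ?f) j"
    using deg nz by (simp add: exact_degree_def)
  ultimately show ?thesis by blast
qed

text \<open>The polynomial now has degree \<open>Suc j\<close>, so \<open>s\<close> roots refute it
  only for \<open>Suc j < s\<close>. This is where \<open>\<beta> (Suc s)\<close> escapes the
  argument.\<close>

lemma beta_step:
  assumes p: "represents_p (Suc j) \<psi>" "exact_degree \<psi> j"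
    and q: "represents_q (Suc j) \<phi>" "exact_degree \<phi> j" and j: "Suc j < s"
  shows "\<beta> (Suc (Suc j)) \<noteq> 0 \<and> (\<exists>\<psi>'. represents_p (Suc (Suc j)) \<psi>' \<and> exact_degree \<psi>' (Suc j))"
proof -
  \<comment> \<open>\<open>pCons 0 \<phi>\<close> multiplies \<open>\<phi>\<close> by the variable:
    the pairing of \<open>u i\<close> with \<open>A q\<close> is that of \<open>A^T u i\<close> with
    \<open>q\<close>, which contains the factor \<open>(\<sigma> i)^2\<close>.\<close>
  let ?f = "pCons 0 \<phi> - Polynomial.smult (\<alpha> (Suc j)) \<psi>"
  have deg: "?f \<noteq> 0" "degree ?f = Suc j"
  proof -
    have "coeff (Polynomial.smult (\<alpha> (Suc j)) \<psi>) (Suc j) = 0"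
      using p(2) by (auto simp: coeff_eq_0 exact_degree_def)
    hence lead: "coeff ?f (Suc j) = lead_coeff \<phi>"
      using q(2) by (simp add: exact_degree_def)
    hence "coeff ?f (Suc j) \<noteq> 0" using q(2) by (auto simp: exact_degree_def)
    moreover have "degree ?f \<le> Suc j"
      using q(2) p(2) by (intro degree_diff_le) (auto simp: exact_degree_def intro: order_trans[OF degree_smult_le])
    ultimately show "?f \<noteq> 0" "degree ?f = Suc j"
      using le_degree[of ?f "Suc j"] coeff_0[of "Suc j"] by (metis, metis antisym)
  qed
  have eq: "\<beta> (Suc (Suc j)) * (u i \<bullet> p (Suc (Suc j))) = (u i \<bullet> b) * poly ?f ((\<sigma> i)\<^sup>2)"
    if i: "i \<in> {1..s}" for i
    using scalar_At_u(2)[OF i, of "q (Suc j)"] scalar_A_q[of "u i" j] u[OF i] p(1) q(1) i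
    by (simp add: represents_p_def represents_q_def algebra_simps)
  have nz: "\<beta> (Suc (Suc j)) \<noteq> 0"
  proof
    assume "\<beta> (Suc (Suc j)) = 0"
    hence "poly ?f ((\<sigma> i)\<^sup>2) = 0" if "i \<in> {1..s}" for i
      using eq[OF that] u_b[OF that] by simp
    hence "?f = 0" by (rule poly_zero_if_many_roots[OF squares_inj]) (use deg(2) j in simp_all)
    with deg(1) show False by contradiction
  qed
  moreover have "represents_p (Suc (Suc j)) (Polynomial.smult (1 / \<beta> (Suc (Suc j))) ?f)"
    using eq nz unfolding represents_p_def by (auto simp: field_simps)
  moreover have "exact_degree (Polynomial.smult (1 / \<beta> (Suc (Suc j))) ?f) (Suc j)"
    using deg nz by (simp add: exact_degree_def)
  ultimately show ?thesis by blast
qed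

lemma no_breakdown_aux:
  "j < s \<Longrightarrow> \<alpha> (Suc j) \<noteq> 0 \<and> \<beta> (Suc j) \<noteq> 0 \<and>
    (\<exists>\<psi> \<phi>. represents_p (Suc j) \<psi> \<and> exact_degree \<psi> j \<and>
      represents_q (Suc j) \<phi> \<and> exact_degree \<phi> j)"
proof (induction j)
  case 0
  hence 1: "1 \<in> {1..s}" by simp
  have nz: "\<beta> (Suc 0) \<noteq> 0"
    using vnorm_eq_0_iff[OF b] u_b[OF 1] u[OF 1] unfolding beta_1 by auto
  have "represents_p (Suc 0) [:1 / \<beta> (Suc 0):]"
    unfolding represents_p_def p_1 using scalar_prod_smult_distrib[OF u b] by auto
  moreover have "exact_degree [:1 / \<beta> (Suc 0):] 0"
    using nz by (simp add: exact_degree_def)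
  moreover have "represents_q 0 0"
    unfolding represents_q_def q_0 using At u by auto
  ultimately show ?case using alpha_step[of 0 _ 0] 0 nz by blast
next
  case (Suc j)
  then obtain \<psi> \<phi> where IH: "represents_p (Suc j) \<psi>" "exact_degree \<psi> j"
      "represents_q (Suc j) \<phi>" "exact_degree \<phi> j"
    by auto
  obtain \<psi>' where \<psi>': "\<beta> (Suc (Suc j)) \<noteq> 0" "represents_p (Suc (Suc j)) \<psi>'" "exact_degree \<psi>' (Suc j)"
    using beta_step[OF IH Suc.prems] by blast
  have "\<phi> = 0 \<or> degree \<phi> < Suc j" using IH(4) by (simp add: exact_degree_def)
  from alpha_step[OF \<psi>'(2,3) IH(3) this Suc.prems] \<psi>' show ?case by blast
qed

lemma no_breakdown: "j < s \<Longrightarrow> \<alpha> (Suc j) \<noteq> 0" "j < s \<Longrightarrow> \<beta> (Suc j) \<noteq> 0"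
  using no_breakdown_aux by blast+

section \<open>The span of the right vectors and its projector\<close>

abbreviation "v i \<equiv> right_vec A (\<sigma> i) (u i)"
definition "N = mat_of_cols n (map v [1..<Suc s])"

lemma v: "i \<in> {1..s} \<Longrightarrow> v i \<in> carrier_vec n"
  using At u by (simp add: right_vec_def)

lemma N [simp]: "N \<in> carrier_mat n s"
  unfolding N_def using mat_of_cols_carrier(1)[of n "map v [1..<Suc s]"] by (simp del: upt_Suc)

lemma N_dim [simp]: "dim_row N = n" "dim_col N = s"
  using carrier_matD[OF N] by auto

lemma N_index: "t < n \<Longrightarrow> i < s \<Longrightarrow> N $$ (t, i) = v (Suc i) $ t"
  by (simp add: N_def mat_of_cols_index del: upt_Suc)

lemma col_N: "i < s \<Longrightarrow> col N i = v (Suc i)"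
  using v[of "Suc i"] by (simp add: N_def del: upt_Suc)

lemma gram_v: "i \<in> {1..s} \<Longrightarrow> gram *\<^sub>v v i = (\<sigma> i)\<^sup>2 \<cdot>\<^sub>v v i"
proof -
  assume i: "i \<in> {1..s}"
  have Au: "A\<^sup>T *\<^sub>v u i \<in> carrier_vec n" using At u[OF i] by simp
  have "gram *\<^sub>v v i = (1 / \<sigma> i) \<cdot>\<^sub>v (gram *\<^sub>v (A\<^sup>T *\<^sub>v u i))"
    unfolding right_vec_def by (rule mult_mat_vec[OF gram Au])
  also have "gram *\<^sub>v (A\<^sup>T *\<^sub>v u i) = A\<^sup>T *\<^sub>v ((\<sigma> i)\<^sup>2 \<cdot>\<^sub>v u i)"
    unfolding gram_mult[OF Au] eigenvector[OF i] ..
  also have "\<dots> = (\<sigma> i)\<^sup>2 \<cdot>\<^sub>v (A\<^sup>T *\<^sub>v u i)"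
    by (rule mult_mat_vec[OF At u[OF i]])
  finally show ?thesis
    by (simp add: right_vec_def smult_smult_assoc mult.commute)
qed

lemma A_v: "i \<in> {1..s} \<Longrightarrow> A *\<^sub>v v i = \<sigma> i \<cdot>\<^sub>v u i"
proof -
  assume i: "i \<in> {1..s}"
  have "A *\<^sub>v v i = (1 / \<sigma> i) \<cdot>\<^sub>v (A *\<^sub>v (A\<^sup>T *\<^sub>v u i))"
    unfolding right_vec_def by (rule mult_mat_vec[OF A]) (use At u[OF i] in simp)
  thus ?thesis
    unfolding eigenvector[OF i] using \<sigma>_pos[OF i]
    by (simp add: smult_smult_assoc power2_eq_square)
qed

text \<open>With the \<open>v i\<close> orthonormal this is the orthogonal projector onto their
  span, and \<open>A * Z\<close> is the sum of the rank one matrices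
  \<open>\<sigma> i * u i * (v i)^T\<close>. The proof works with two properties: \<open>Z\<close>
  commutes with \<open>gram\<close> and fixes \<open>A^T b\<close>. Hence it fixes every Krylov
  vector.\<close>

abbreviation "Z \<equiv> N * N\<^sup>T"

lemma Z: "Z \<in> carrier_mat n n"
  by (intro carrier_matI) simp_all

text \<open>Since the columns of \<open>N\<close> are eigenvectors,
  \<open>gram * Z = N * D * N^T\<close> with \<open>D\<close> diagonal, which is symmetric. As
  \<open>gram\<close> and \<open>Z\<close> are symmetric too, taking transposes exchanges the
  factors.\<close>

lemma Z_gram: "Z * gram = gram * Z"
proof -
  let ?D = "mat_diag s (\<lambda>i. (\<sigma> (Suc i))\<^sup>2)"
  have D: "?D \<in> carrier_mat s s" by (simp add: mat_diag_def)
  have gN: "gram * N = N * ?D"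
  proof (rule mat_col_eqI)
    fix i assume "i < dim_col (N * ?D)"
    hence i: "i < s" by (simp add: mat_diag_def)
    have "col (gram * N) i = gram *\<^sub>v v (Suc i)"
      using col_mult2[OF gram N i] col_N[OF i] by simp
    also have "\<dots> = col (N * ?D) i"
      using i v[of "Suc i"] N_index
      by (intro eq_vecI) (auto simp: gram_v mat_diag_mult_right[OF N])
    finally show "col (gram * N) i = col (N * ?D) i" .
  qed (use A in \<open>simp_all add: mat_diag_def\<close>)
  have gram_sym: "gram\<^sup>T = gram"
    using A by (simp add: transpose_mult[of _ n m])
  have eq: "gram * Z = N * ?D * N\<^sup>T"
    using assoc_mult_mat[OF gram N, of "N\<^sup>T" n] gN by simp
  have "Z * gram = (gram * Z)\<^sup>T"
    using transpose_mult[OF gram Z] transpose_mult[OF N, of "N\<^sup>T" n] gram_sym by simp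
  also have "\<dots> = N * (?D * N\<^sup>T)"
  proof -
    have "(N * ?D * N\<^sup>T)\<^sup>T = N * (N * ?D)\<^sup>T"
      using transpose_mult[of "N * ?D" n s "N\<^sup>T" n] mult_carrier_mat[OF N D] transpose_carrier_mat[of N] N by (simp del: N)
    also have "(N * ?D)\<^sup>T = ?D\<^sup>T * N\<^sup>T" by (rule transpose_mult[OF N D])
    also have "?D\<^sup>T = ?D" by (auto simp: mat_diag_def intro!: eq_matI)
    finally show ?thesis unfolding eq .
  qed
  also have "\<dots> = gram * Z"
    unfolding eq using assoc_mult_mat[OF N D, of "N\<^sup>T" n] by simp
  finally show ?thesis .
qed

text \<open>The pairing of \<open>v i\<close> with \<open>A^T b\<close> equals
  \<open>\<sigma> i\<close> times that of \<open>u i\<close> with \<open>b\<close>, which is exactly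
  the coefficient of \<open>v i\<close> in \<open>At_b_expansion\<close>.\<close>

lemma Z_At_b: "Z *\<^sub>v (A\<^sup>T *\<^sub>v b) = A\<^sup>T *\<^sub>v b"
proof (rule eq_vecI)
  fix t assume "t < dim_vec (A\<^sup>T *\<^sub>v b)"
  hence t: "t < n" using A by simp
  have *: "v i \<bullet> (A\<^sup>T *\<^sub>v b) = \<sigma> i * (u i \<bullet> b)" if i: "i \<in> {1..s}" for i
    using scalar_At_u(1)[OF i b] At u[OF i] At_b \<sigma>_pos[OF i]
    by (simp add: right_vec_def power2_eq_square)
  have "Z *\<^sub>v (A\<^sup>T *\<^sub>v b) = N *\<^sub>v (N\<^sup>T *\<^sub>v (A\<^sup>T *\<^sub>v b))"
    by (rule assoc_mult_mat_vec[of _ n s _ n]) (use At_b in simp_all)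
  also have "N\<^sup>T *\<^sub>v (A\<^sup>T *\<^sub>v b) = vec s (\<lambda>i. \<sigma> (Suc i) * (u (Suc i) \<bullet> b))"
    by (intro eq_vecI) (use * col_N in auto)
  also have "(N *\<^sub>v \<dots>) $ t = (\<Sum>i<s. v (Suc i) $ t * (\<sigma> (Suc i) * (u (Suc i) \<bullet> b)))"
    using t by (simp add: scalar_prod_def N_index atLeast0LessThan)
  also have "\<dots> = (\<Sum>i<s. (u (Suc i) \<bullet> b) * (A\<^sup>T *\<^sub>v u (Suc i)) $ t)"
  proof (rule sum.cong[OF refl])
    fix i assume "i \<in> {..<s}"
    hence "\<sigma> (Suc i) \<noteq> 0" using \<sigma>_pos[of "Suc i"] by auto
    thus "v (Suc i) $ t * (\<sigma> (Suc i) * (u (Suc i) \<bullet> b)) = (u (Suc i) \<bullet> b) * (A\<^sup>T *\<^sub>v u (Suc i)) $ t"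
      using A t by (simp add: right_vec_def)
  qed
  also have "\<dots> = (\<Sum>i\<in>{1..s}. (u i \<bullet> b) * (A\<^sup>T *\<^sub>v u i) $ t)"
    by (rule sum.reindex_bij_witness[of _ "\<lambda>i. i - 1" Suc]) auto
  finally show "(Z *\<^sub>v (A\<^sup>T *\<^sub>v b)) $ t = (A\<^sup>T *\<^sub>v b) $ t"
    using At_b_expansion[OF t] by simp
qed (use A in simp)

lemma Z_krylov_vec: "Z *\<^sub>v krylov_vec i = krylov_vec i"
proof (induction i)
  case 0
  show ?case unfolding krylov_vec_0 by (rule Z_At_b)
next
  case (Suc i)
  have "Z *\<^sub>v (gram *\<^sub>v krylov_vec i) = gram *\<^sub>v (Z *\<^sub>v krylov_vec i)"
    using assoc_mult_mat_vec[OF Z gram krylov_vec_carrier] assoc_mult_mat_vec[OF gram Z krylov_vec_carrier]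
    by (metis Z_gram)
  thus ?case unfolding krylov_vec_Suc Suc .
qed

lemma A_Z_q: "(A * Z) *\<^sub>v q (Suc j) = A *\<^sub>v q (Suc j)"
proof -
  have AZ: "A * Z \<in> carrier_mat m n" using A Z by simp
  have "(A * Z) *\<^sub>v w = A *\<^sub>v w" if "w \<in> krylov_vec ` {..<Suc j}" for w
    using that Z_krylov_vec assoc_mult_mat_vec[OF A Z] by auto
  thus ?thesis
    using vspan_cong_mult[OF _ krylov_vecs_carrier AZ A] vectors_in_krylov[of j] by blast
qed

end

section \<open>The LSQR iterate\<close>

context spectral_bidiagonalization
begin

context
  fixes k :: nat
  assumes k: "k \<in> {1..s}"
begin

abbreviation "nr \<equiv> gk_rows A b s k"
abbreviation "P \<equiv> gk_P A b s k"
abbreviation "B \<equiv> gk_B A b s k"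
abbreviation "Q \<equiv> gk_Q A b k"
abbreviation "rhs \<equiv> gk_rhs A b s k"

lemma nr_bounds: "k \<le> nr" "nr \<le> Suc k"
  by (simp_all add: gk_rows_def)

lemma beta_eq_0_if_truncated: "nr \<le> k \<Longrightarrow> \<beta> (Suc k) = 0"
  by (simp add: gk_rows_def split: if_splits)

lemma alpha_nonzero: "i < k \<Longrightarrow> \<alpha> (Suc i) \<noteq> 0"
  using no_breakdown(1)[of i] k by simp

lemma beta_nonzero: "i < k \<Longrightarrow> \<beta> (Suc i) \<noteq> 0"
  using no_breakdown(2)[of i] k by simp

lemma P_carrier: "P \<in> carrier_mat m nr"
  using A mat_of_cols_carrier(1)[of m "map p [1..<Suc nr]"] by (simp add: gk_P_def del: upt_Suc)

lemma Q_carrier: "Q \<in> carrier_mat n k"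
  using A mat_of_cols_carrier(1)[of n "map q [1..<Suc k]"] by (simp add: gk_Q_def del: upt_Suc)

lemma B_carrier: "B \<in> carrier_mat nr k"
  by (simp add: gk_B_def)

lemma rhs_carrier: "rhs \<in> carrier_vec nr"
  by (simp add: gk_rhs_def)

lemma col_P: "j < nr \<Longrightarrow> col P j = p (Suc j)"
  using A by (simp add: gk_P_def del: upt_Suc)

lemma col_Q: "j < k \<Longrightarrow> col Q j = q (Suc j)"
  using A by (simp add: gk_Q_def del: upt_Suc)

lemma set_cols_Q: "set (cols Q) = (\<lambda>i. q (Suc i)) ` {..<k}"
  using Q_carrier col_Q by (auto simp: cols_def atLeast0LessThan image_def)

lemma orthonormal_Q: "orthonormal_columns Q"
  unfolding gk_Q_def
proof (rule orthonormal_columns_mat_of_cols)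
  fix i j assume "i < length (map q [1..<Suc k])" "j < length (map q [1..<Suc k])"
  thus "map q [1..<Suc k] ! i \<bullet> map q [1..<Suc k] ! j = (if i = j then 1 else 0)"
    using orthonormal_vectors[of k i j] alpha_nonzero beta_nonzero by (simp del: upt_Suc)
qed (use A in auto)

lemma orthonormal_P: "orthonormal_columns P"
  unfolding gk_P_def
proof (rule orthonormal_columns_mat_of_cols)
  fix i j assume ij: "i < length (map p [1..<Suc nr])" "j < length (map p [1..<Suc nr])"
  have "p (Suc i) \<bullet> p (Suc j) = (if i = j then 1 else 0)"
  proof (cases "nr = k")
    case True
    thus ?thesis using ij orthonormal_vectors[of k i j] alpha_nonzero beta_nonzero by (simp del: upt_Suc)
  next
    case False
    hence nr: "nr = Suc k" using nr_bounds by simp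
    \<comment> \<open>Below \<open>s\<close> this is absence of breakdown; at
      \<open>i = k = s\<close> it is the condition under which \<open>gk_rows\<close> keeps the
      extra row.\<close>
    have "\<beta> (Suc i) \<noteq> 0" if "i \<le> k" for i
    proof (cases "i < s")
      case True
      thus ?thesis by (rule no_breakdown(2))
    next
      case False
      hence "i = s" "k = s" using that k by auto
      thus ?thesis using nr by (auto simp: gk_rows_def split: if_splits)
    qed
    thus ?thesis using ij nr orthonormal_p_Suc[of k i j] alpha_nonzero by (simp del: upt_Suc)
  qed
  thus "map p [1..<Suc nr] ! i \<bullet> map p [1..<Suc nr] ! j = (if i = j then 1 else 0)"
    using ij by (simp del: upt_Suc)
qed (use A in auto)

lemma A_Q: "A * Q = P * B"
proof (rule mat_col_eqI)
  fix j assume "j < dim_col (P * B)"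
  hence j: "j < k" using B_carrier by simp
  have "col (A * Q) j = A *\<^sub>v q (Suc j)"
    using col_mult2[OF A Q_carrier j] col_Q[OF j] by simp
  also have "\<dots> = P *\<^sub>v col B j"
  proof (cases "Suc j < nr")
    case True
    have "col B j = \<alpha> (Suc j) \<cdot>\<^sub>v unit_vec nr j + \<beta> (Suc (Suc j)) \<cdot>\<^sub>v unit_vec nr (Suc j)"
      using j True by (intro eq_vecI) (auto simp: gk_B_def)
    thus ?thesis
      using True P_carrier by (simp add: A_q mult_add_distrib_mat_vec[OF P_carrier]
          mult_mat_vec[OF P_carrier] mult_unit_vec[OF P_carrier] col_P)
  next
    case False
    \<comment> \<open>The truncated shape: the subdiagonal entry of the last column would fall below
      \<open>B\<close>, and the term of \<open>A_q\<close> that it should represent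
      vanishes.\<close>
    hence last: "k = Suc j" "nr = k" using j nr_bounds by auto
    have "col B j = \<alpha> (Suc j) \<cdot>\<^sub>v unit_vec nr j"
      using last by (intro eq_vecI) (auto simp: gk_B_def)
    moreover have "A *\<^sub>v q (Suc j) = \<alpha> (Suc j) \<cdot>\<^sub>v p (Suc j)"
      unfolding A_q using beta_eq_0_if_truncated last by (intro eq_vecI) auto
    moreover have "P *\<^sub>v (\<alpha> (Suc j) \<cdot>\<^sub>v unit_vec nr j) = \<alpha> (Suc j) \<cdot>\<^sub>v p (Suc j)"
      using j nr_bounds by (simp add: mult_mat_vec[OF P_carrier] mult_unit_vec[OF P_carrier] col_P)
    ultimately show ?thesis by (simp only:)
  qed
  also have "\<dots> = col (P * B) j"
    by (rule col_mult2[OF P_carrier B_carrier j, symmetric])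
  finally show "col (A * Q) j = col (P * B) j" .
qed (use A P_carrier Q_carrier B_carrier in auto)

lemma P_rhs: "P *\<^sub>v rhs = b"
  using k nr_bounds beta_p_1
  by (simp add: gk_rhs_def mult_mat_vec[OF P_carrier] mult_unit_vec[OF P_carrier] col_P)

text \<open>Forward substitution: the first \<open>k\<close> rows of \<open>B\<close> form a lower
  triangular matrix whose diagonal entries \<open>\<alpha>\<close> are nonzero.\<close>

lemma B_injective:
  assumes y: "y \<in> carrier_vec k" and By: "B *\<^sub>v y = 0\<^sub>v nr"
  shows "y = 0\<^sub>v k"
proof -
  have "i < k \<Longrightarrow> y $ i = 0" for i
  proof (induction i rule: less_induct)
    case (less i)
    have "0 = (B *\<^sub>v y) $ i"
      using By less.prems nr_bounds by simp
    also have "\<dots> = (\<Sum>j<k. B $$ (i, j) * y $ j)"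
      using y B_carrier less.prems nr_bounds
      by (auto simp: scalar_prod_def atLeast0LessThan intro!: sum.cong)
    also have "\<dots> = (\<Sum>j\<in>{i}. B $$ (i, j) * y $ j)"
    proof (rule sum.mono_neutral_right)
      show "\<forall>j\<in>{..<k} - {i}. B $$ (i, j) * y $ j = 0"
      proof
        fix j assume j: "j \<in> {..<k} - {i}"
        show "B $$ (i, j) * y $ j = 0"
          using less.IH[of j] j less.prems nr_bounds
          by (cases "j < i") (auto simp: gk_B_def)
      qed
    qed (use less.prems in auto)
    also have "\<dots> = \<alpha> (Suc i) * y $ i"
      using less.prems nr_bounds by (simp add: gk_B_def)
    finally show "y $ i = 0" using alpha_nonzero[OF less.prems] by simp
  qed
  thus ?thesis using y by (intro eq_vecI) auto
qed

lemma PB_carrier: "P * B \<in> carrier_mat m k"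
  using P_carrier B_carrier by simp

lemma PB_injective:
  assumes y: "y \<in> carrier_vec k" and "(P * B) *\<^sub>v y = 0\<^sub>v m"
  shows "y = 0\<^sub>v k"
proof (rule B_injective[OF y])
  have By: "B *\<^sub>v y \<in> carrier_vec nr" using B_carrier y by simp
  have "P *\<^sub>v (B *\<^sub>v y) = 0\<^sub>v m"
    using assms assoc_mult_mat_vec[OF P_carrier B_carrier y] by simp
  hence "B *\<^sub>v y = P\<^sup>T *\<^sub>v 0\<^sub>v m"
    using orthonormal_columns_isometry(1)[OF P_carrier orthonormal_P By] by simp
  also have "\<dots> = 0\<^sub>v nr"
    using P_carrier by (intro eq_vecI) auto
  finally show "B *\<^sub>v y = 0\<^sub>v nr" .
qed

text \<open>\<open>Q^T\<close> is onto because \<open>Q^T Q\<close> is the identity, so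
  \<open>P * B * Q^T\<close> has the range of the injective matrix \<open>P * B\<close>.\<close>

lemma rank_PBQ: "vec_space.rank m (P * B * Q\<^sup>T) = k"
proof -
  have "vec_space.rank m (P * B * Q\<^sup>T) = vec_space.rank m (P * B)"
  proof (rule rank_cong[OF _ PB_carrier])
    show "P * B * Q\<^sup>T \<in> carrier_mat m n" using PB_carrier Q_carrier by simp
    have eq: "(P * B * Q\<^sup>T) *\<^sub>v x = (P * B) *\<^sub>v (Q\<^sup>T *\<^sub>v x)" if "x \<in> carrier_vec n" for x
      by (rule assoc_mult_mat_vec[OF PB_carrier _ that]) (use Q_carrier in simp)
    show "{(P * B * Q\<^sup>T) *\<^sub>v x |x. x \<in> carrier_vec n} = {(P * B) *\<^sub>v y |y. y \<in> carrier_vec k}"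
    proof (intro equalityI subsetI)
      fix z assume "z \<in> {(P * B * Q\<^sup>T) *\<^sub>v x |x. x \<in> carrier_vec n}"
      then obtain x where x: "x \<in> carrier_vec n" "z = (P * B) *\<^sub>v (Q\<^sup>T *\<^sub>v x)"
        using eq by auto
      moreover have "Q\<^sup>T *\<^sub>v x \<in> carrier_vec k" using Q_carrier x by simp
      ultimately show "z \<in> {(P * B) *\<^sub>v y |y. y \<in> carrier_vec k}" by blast
    next
      fix z assume "z \<in> {(P * B) *\<^sub>v y |y. y \<in> carrier_vec k}"
      then obtain y where y: "y \<in> carrier_vec k" "z = (P * B) *\<^sub>v y" by blast
      have Qy: "Q *\<^sub>v y \<in> carrier_vec n" using Q_carrier y by simp
      have "z = (P * B * Q\<^sup>T) *\<^sub>v (Q *\<^sub>v y)"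
        using eq[OF Qy] orthonormal_columns_isometry(1)[OF Q_carrier orthonormal_Q y(1)] y(2) by simp
      with Qy show "z \<in> {(P * B * Q\<^sup>T) *\<^sub>v x |x. x \<in> carrier_vec n}" by blast
    qed
  qed
  also have "\<dots> = k" by (rule rank_injective[OF PB_carrier PB_injective])
  finally show ?thesis .
qed

text \<open>Only \<open>M * Q\<close> enters the projection, and \<open>P P^T\<close> leaves
  \<open>M * Q = P * B\<close> unchanged. The general \<open>M\<close> serves both the original and
  the modified matrix.\<close>

lemma rank_approximation_PBQ:
  assumes M: "M \<in> carrier_mat m n" and MQ: "M * Q = A * Q"
  shows "rank_approximation M k P B Q"
proof -
  have Pt: "P\<^sup>T \<in> carrier_mat nr m" and Qt: "Q\<^sup>T \<in> carrier_mat k n"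
    using P_carrier Q_carrier by simp_all
  have PP: "P * P\<^sup>T \<in> carrier_mat m m" and PPM: "(P * P\<^sup>T) * M \<in> carrier_mat m n"
    using P_carrier Pt M by auto
  have "(P * P\<^sup>T) * M * (Q * Q\<^sup>T) = ((P * P\<^sup>T) * (M * Q)) * Q\<^sup>T"
    using assoc_mult_mat[OF PPM Q_carrier Qt] assoc_mult_mat[OF PP M Q_carrier] by simp
  also have "(P * P\<^sup>T) * (M * Q) = P * ((P\<^sup>T * P) * B)"
    unfolding MQ A_Q
    using assoc_mult_mat[OF P_carrier Pt PB_carrier] assoc_mult_mat[OF Pt P_carrier B_carrier] by simp
  also have "P\<^sup>T * P = 1\<^sub>m nr"
    using orthonormal_P P_carrier by (simp add: orthonormal_columns_def)
  finally have "P * B * Q\<^sup>T = (P * P\<^sup>T) * M * (Q * Q\<^sup>T)"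
    using B_carrier by simp
  thus ?thesis
    using orthonormal_P orthonormal_Q rank_PBQ M by (simp add: rank_approximation_def)
qed

text \<open>Because \<open>P\<close> is an isometry on coefficients and
  \<open>P *\<^sub>v rhs = b\<close>, the small problem with \<open>B\<close> has the same residuals
  as the one with \<open>P * B\<close>. So \<open>y\<close> is the solution of its normal equations
  and \<open>x\<close> is \<open>Q\<close> applied to it.\<close>

lemma lsqr_properties:
  fixes A' :: "real mat"
  assumes A': "A' \<in> carrier_mat m n" and A'_eq: "A' = A * Z"
  defines "x \<equiv> lsqr_iterate A b k" and "y \<equiv> lsqr_y A b s k"
  shows "min_norm_ls_solution (P * B * Q\<^sup>T) b x' \<longleftrightarrow> x' = x"
    and "rank_approximation A k P B Q"
    and "rank_approximation A' k P B Q"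
    and "vnorm (A *\<^sub>v x - b) = vnorm (A' *\<^sub>v x - b)"
    and "vnorm (A' *\<^sub>v x - b) = vnorm (B *\<^sub>v y - rhs)"
proof -
  obtain y\<^sub>0 where y\<^sub>0: "y\<^sub>0 \<in> carrier_vec k" "(P * B)\<^sup>T *\<^sub>v ((P * B) *\<^sub>v y\<^sub>0 - b) = 0\<^sub>v k"
    using least_squares_exists[OF PB_carrier b PB_injective] by blast
  interpret least_squares "P * B" b y\<^sub>0 m k
    by unfold_locales (use PB_carrier b y\<^sub>0 PB_injective in auto)
  have "krylov k gram (A\<^sup>T *\<^sub>v b) = {Q *\<^sub>v y |y. y \<in> carrier_vec k}"
    unfolding krylov_eq_vspan_q set_cols_Q[symmetric] by (rule vspan_cols[OF Q_carrier])
  hence x: "x = Q *\<^sub>v y\<^sub>0"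
    unfolding x_def lsqr_iterate_def
    using arg_min_on_range[OF Q_carrier orthonormal_Q A A_Q] by simp
  show "min_norm_ls_solution (P * B * Q\<^sup>T) b x' \<longleftrightarrow> x' = x"
    unfolding x by (rule min_norm_ls_solution_iff[OF Q_carrier orthonormal_Q])
  show "rank_approximation A k P B Q"
    by (rule rank_approximation_PBQ[OF A refl])
  have A'_Q: "A' * Q = A * Q"
  proof (rule mat_col_eqI)
    fix j assume "j < dim_col (A * Q)"
    hence j: "j < k" using Q_carrier by simp
    show "col (A' * Q) j = col (A * Q) j"
      unfolding col_mult2[OF A' Q_carrier j] col_mult2[OF A Q_carrier j] col_Q[OF j]
      unfolding A'_eq by (rule A_Z_q)
  qed (use A A' in auto)
  show "rank_approximation A' k P B Q"
    by (rule rank_approximation_PBQ[OF A' A'_Q])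
  have A_x: "A *\<^sub>v x = (P * B) *\<^sub>v y\<^sub>0"
    unfolding x A_Q[symmetric] by (rule assoc_mult_mat_vec[OF A Q_carrier y\<^sub>0(1), symmetric])
  have A'_x: "A' *\<^sub>v x = A *\<^sub>v x"
    unfolding x using assoc_mult_mat_vec[OF A Q_carrier y\<^sub>0(1)] assoc_mult_mat_vec[OF A' Q_carrier y\<^sub>0(1)]
    by (simp add: A'_Q)
  thus "vnorm (A *\<^sub>v x - b) = vnorm (A' *\<^sub>v x - b)" by simp
  have B_eq: "vnorm (B *\<^sub>v z - rhs) = vnorm ((P * B) *\<^sub>v z - b)" if z: "z \<in> carrier_vec k" for z
  proof -
    have Bz: "B *\<^sub>v z \<in> carrier_vec nr" using B_carrier z by simp
    have "vnorm (B *\<^sub>v z - rhs) = vnorm (P *\<^sub>v (B *\<^sub>v z - rhs))"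
      using orthonormal_columns_isometry(2)[OF P_carrier orthonormal_P] Bz rhs_carrier by simp
    also have "P *\<^sub>v (B *\<^sub>v z - rhs) = P *\<^sub>v (B *\<^sub>v z) - b"
      using mult_minus_distrib_mat_vec[OF P_carrier Bz rhs_carrier] P_rhs by simp
    also have "P *\<^sub>v (B *\<^sub>v z) = (P * B) *\<^sub>v z"
      by (rule assoc_mult_mat_vec[OF P_carrier B_carrier z, symmetric])
    finally show ?thesis .
  qed
  have "is_arg_min (\<lambda>y. vnorm (B *\<^sub>v y - rhs)) (\<lambda>y. y \<in> carrier_vec k) z
      \<longleftrightarrow> z \<in> carrier_vec k \<and> z = y\<^sub>0" for z
    by (rule is_arg_min_residual_iff[where g = "\<lambda>y. y"]) (use B_eq in auto)
  hence "y = y\<^sub>0"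
    unfolding y_def lsqr_y_def arg_min_on_def arg_min_def using y\<^sub>0 by auto
  thus "vnorm (A' *\<^sub>v x - b) = vnorm (B *\<^sub>v y - rhs)"
    using B_eq[OF y\<^sub>0(1)] A'_x A_x by simp
qed

end

end

section \<open>The grouped singular value decomposition\<close>

text \<open>The zeros of the diagonal cut the product off at \<open>s\<close>, where
  \<open>xs\<close> and \<open>ys\<close> begin, and \<open>A_v\<close> turns each remaining
  \<open>\<sigma> i\<close> times \<open>u i\<close> into \<open>A\<close> applied to
  \<open>v i\<close>.\<close>

lemma (in spectral_bidiagonalization) modified_eq_A_Z:
  assumes len: "length xs = n - s" "length ys = n - s" and s: "s \<le> n"
  shows "mat_of_cols m (map u [1..<Suc s] @ xs) * mat_diag n (\<lambda>i. if i < s then \<sigma> (Suc i) else 0)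
    * (mat_of_cols n (map v [1..<Suc s] @ ys))\<^sup>T = A * Z"
    (is "?U * ?D * ?V\<^sup>T = _")
proof (rule eq_matI)
  have U: "?U \<in> carrier_mat m n" and V: "?V \<in> carrier_mat n n"
    using mat_of_cols_carrier(1)[of m "map u [1..<Suc s] @ xs"]
      mat_of_cols_carrier(1)[of n "map v [1..<Suc s] @ ys"] len s by (simp_all del: upt_Suc)
  have UD: "?U * ?D = mat m n (\<lambda>(a, i). ?U $$ (a, i) * (if i < s then \<sigma> (Suc i) else 0))"
    by (rule mat_diag_mult_right[OF U])
  fix a t assume "a < dim_row (A * Z)" "t < dim_col (A * Z)"
  hence at: "a < m" "t < n" using A by simp_all
  have "(?U * ?D * ?V\<^sup>T) $$ (a, t) = (\<Sum>i<n. ?U $$ (a, i) * (if i < s then \<sigma> (Suc i) else 0) * ?V $$ (t, i))"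
    unfolding UD using at U V len s
    by (simp add: scalar_prod_def atLeast0LessThan del: upt_Suc)
  also have "\<dots> = (\<Sum>i<s. ?U $$ (a, i) * (if i < s then \<sigma> (Suc i) else 0) * ?V $$ (t, i))"
    by (rule sum.mono_neutral_right) (use s in auto)
  also have "\<dots> = (\<Sum>i<s. (A * N) $$ (a, i) * N $$ (t, i))"
  proof (rule sum.cong[OF refl])
    fix i assume "i \<in> {..<s}"
    hence i: "i < s" by simp
    have "(A * N) $$ (a, i) = (A *\<^sub>v v (Suc i)) $ a"
      using col_mult2[OF A N i] col_N[OF i] A at i by (metis col_mult2 index_col index_mult_mat(2,3) N_dim(2) carrier_matD(1))
    also have "\<dots> = \<sigma> (Suc i) * u (Suc i) $ a"
      using A_v[of "Suc i"] u[of "Suc i"] at i by simp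
    finally show "?U $$ (a, i) * (if i < s then \<sigma> (Suc i) else 0) * ?V $$ (t, i) = (A * N) $$ (a, i) * N $$ (t, i)"
      using i at len s N_index[OF at(2) i]
      by (simp add: mat_of_cols_index nth_append del: upt_Suc)
  qed
  also have "\<dots> = (A * N * N\<^sup>T) $$ (a, t)"
    using at A by (simp add: scalar_prod_def atLeast0LessThan)
  also have "A * N * N\<^sup>T = A * Z"
    using assoc_mult_mat[OF A N, of "N\<^sup>T" n] by simp
  finally show "(?U * ?D * ?V\<^sup>T) $$ (a, t) = (A * Z) $$ (a, t)" .
qed (use A in simp_all)

text \<open>Applied to all of \<open>Uh\<close> and to a single block, it makes the contribution of
  the block visible as a part of the full sum.\<close>

lemma mult_transpose_index:
  fixes C X :: "real mat"
  assumes C: "C \<in> carrier_mat d m" and X: "X \<in> carrier_mat m l" and b: "b \<in> carrier_vec m" and t: "t < d"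
  shows "((C * X) *\<^sub>v (X\<^sup>T *\<^sub>v b)) $ t = (\<Sum>r<l. (C *\<^sub>v col X r) $ t * (col X r \<bullet> b))"
  using assms
  by (auto simp: scalar_prod_def[of "vec l _"] atLeast0LessThan
      simp del: assoc_mult_mat_vec intro!: sum.cong)

lemma sum_blocks:
  fixes f :: "nat \<Rightarrow> 'a :: comm_monoid_add" and c :: "nat \<Rightarrow> nat"
  shows "(\<Sum>r<(\<Sum>j=1..<Suc s. c j). f r) = (\<Sum>i=1..s. \<Sum>l<c i. f ((\<Sum>j=1..<i. c j) + l))"
proof (induction s)
  case (Suc s)
  let ?d = "\<Sum>j=1..<Suc s. c j"
  have "(\<Sum>r<?d + c (Suc s). f r) = (\<Sum>r<?d. f r) + (\<Sum>r=?d..<?d + c (Suc s). f r)"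
    by (simp add: lessThan_atLeast0 sum.atLeastLessThan_concat)
  also have "(\<Sum>r=?d..<?d + c (Suc s). f r) = (\<Sum>l<c (Suc s). f (?d + l))"
    using sum.shift_bounds_nat_ivl[of f 0 ?d "c (Suc s)"] by (simp add: lessThan_atLeast0 add.commute)
  finally show ?case using Suc by simp
qed simp

text \<open>\<open>\<tau>\<close> repeats each singular value according to its multiplicity, so that
  the block structure reduces to an offset in the index.\<close>

lemma diag_block_mat_scalars:
  fixes \<sigma> :: "nat \<Rightarrow> 'a :: comm_ring_1" and c :: "nat \<Rightarrow> nat"
  shows "\<exists>\<tau>. diag_block_mat (map (\<lambda>i. \<sigma> i \<cdot>\<^sub>m 1\<^sub>m (c i)) [1..<Suc s]) = mat_diag (\<Sum>j=1..<Suc s. c j) \<tau> \<and>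
    (\<forall>i\<in>{1..s}. \<forall>l<c i. \<tau> ((\<Sum>j=1..<i. c j) + l) = \<sigma> i)"
proof (induction s)
  case 0
  show ?case by (auto simp: mat_diag_def intro!: eq_matI)
next
  case (Suc s)
  let ?d = "\<lambda>i. \<Sum>j=1..<i. c j"
  obtain \<tau> where \<tau>: "diag_block_mat (map (\<lambda>i. \<sigma> i \<cdot>\<^sub>m 1\<^sub>m (c i)) [1..<Suc s]) = mat_diag (?d (Suc s)) \<tau>"
    "\<forall>i\<in>{1..s}. \<forall>l<c i. \<tau> (?d i + l) = \<sigma> i"
    using Suc by blast
  define \<tau>' where "\<tau>' r = (if r < ?d (Suc s) then \<tau> r else \<sigma> (Suc s))" for r
  have "diag_block_mat (map (\<lambda>i. \<sigma> i \<cdot>\<^sub>m 1\<^sub>m (c i)) [1..<Suc (Suc s)]) =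
      diag_block_mat (map (\<lambda>i. \<sigma> i \<cdot>\<^sub>m 1\<^sub>m (c i)) [1..<Suc s] @ [\<sigma> (Suc s) \<cdot>\<^sub>m 1\<^sub>m (c (Suc s))])"
    by simp
  also have "\<dots> = mat_diag (?d (Suc s) + c (Suc s)) \<tau>'"
    unfolding diag_block_mat_last Let_def \<tau>(1)
    by (intro eq_matI) (auto simp: mat_diag_def \<tau>'_def simp del: sum.op_ivl_Suc)
  also have "?d (Suc s) + c (Suc s) = ?d (Suc (Suc s))" by simp
  finally have *: "diag_block_mat (map (\<lambda>i. \<sigma> i \<cdot>\<^sub>m 1\<^sub>m (c i)) [1..<Suc (Suc s)]) = mat_diag (?d (Suc (Suc s))) \<tau>'" .
  have "\<tau>' (?d i + l) = \<sigma> i" if "i \<in> {1..Suc s}" "l < c i" for i l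
  proof (cases "i = Suc s")
    case False
    hence i: "i \<in> {1..s}" using that(1) by auto
    have "?d i + c i = ?d (Suc i)" using i by simp
    also have "\<dots> \<le> ?d (Suc s)" by (rule sum_mono2) (use i in auto)
    finally have "?d i + l < ?d (Suc s)" using that(2) by linarith
    thus ?thesis using \<tau>(2) i that(2) by (simp add: \<tau>'_def)
  qed (simp add: \<tau>'_def)
  with * show ?case by blast
qed

section \<open>Singular vectors and the projections of \<open>b\<close> onto the blocks\<close>

locale svd_setting =
  fixes m n :: nat and A :: "real mat" and s :: nat and \<sigma> :: "nat \<Rightarrow> real" and c :: "nat \<Rightarrow> nat"
    and Uh Vh :: "real mat" and b :: "real vec"
  assumes nm: "n \<le> m" and A: "A \<in> carrier_mat m n" and b: "b \<in> carrier_vec m"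
    and svd: "grouped_svd m n A s \<sigma> c Uh Vh"
    and projections: "\<forall>i\<in>{1..s}. (col_block c Uh i)\<^sup>T *\<^sub>v b \<noteq> 0\<^sub>v (c i)"
begin

lemma Uh: "Uh \<in> carrier_mat m m" "Uh\<^sup>T * Uh = 1\<^sub>m m"
  using svd by (auto simp: grouped_svd_def real_orthogonal_def orthonormal_columns_def)

lemma Vh: "Vh \<in> carrier_mat n n" "Vh\<^sup>T * Vh = 1\<^sub>m n"
  using svd by (auto simp: grouped_svd_def real_orthogonal_def orthonormal_columns_def)

lemma multiplicities: "(\<Sum>i=1..<Suc s. c i) = n" "i \<in> {1..s} \<Longrightarrow> 1 \<le> c i"
  using svd by (auto simp: grouped_svd_def atLeastLessThanSuc_atLeastAtMost)

abbreviation "d i \<equiv> \<Sum>j=1..<i. c j"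

lemma block_index:
  assumes "i \<in> {1..s}" "l < c i"
  shows "d i + l < n"
proof -
  have "d i + c i = d (Suc i)" using assms by simp
  also have "\<dots> \<le> d (Suc s)" by (rule sum_mono2) (use assms in auto)
  finally show ?thesis using assms(2) multiplicities(1) by linarith
qed

text \<open>An orthogonal matrix, transposed, sends its own columns to unit vectors, so
  \<open>A\<close> and \<open>A^T\<close> act on singular vectors through single columns of the
  diagonal factor or its transpose.\<close>

lemma singular_vectors:
  obtains \<tau> where
    "\<And>i l. i \<in> {1..s} \<Longrightarrow> l < c i \<Longrightarrow> \<tau> (d i + l) = \<sigma> i"
    "\<And>r. r < n \<Longrightarrow> A\<^sup>T *\<^sub>v col Uh r = \<tau> r \<cdot>\<^sub>v col Vh r"
    "\<And>r. r < n \<Longrightarrow> A *\<^sub>v col Vh r = \<tau> r \<cdot>\<^sub>v col Uh r"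
    "\<And>r. n \<le> r \<Longrightarrow> r < m \<Longrightarrow> A\<^sup>T *\<^sub>v col Uh r = 0\<^sub>v n"
proof -
  obtain \<tau> where \<tau>: "diag_block_mat (map (\<lambda>i. \<sigma> i \<cdot>\<^sub>m 1\<^sub>m (c i)) [1..<Suc s]) = mat_diag (d (Suc s)) \<tau>"
    "\<forall>i\<in>{1..s}. \<forall>l<c i. \<tau> (d i + l) = \<sigma> i"
    using diag_block_mat_scalars[where s = s and \<sigma> = \<sigma> and c = c] by blast
  define S where "S = mat m n (\<lambda>(i, j). if i = j then \<tau> j else 0)"
  have S: "S \<in> carrier_mat m n" by (simp add: S_def)
  have "mat_diag n \<tau> @\<^sub>r 0\<^sub>m (m - n) n = S"
    unfolding append_rows_def S_def mat_diag_def using nm by (intro eq_matI) auto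
  hence A_eq: "A = Uh * S * Vh\<^sup>T"
    using svd \<tau>(1) unfolding multiplicities(1) by (simp add: grouped_svd_def del: upt_Suc)
  have "A\<^sup>T = (Vh\<^sup>T)\<^sup>T * (Uh * S)\<^sup>T"
    unfolding A_eq by (rule transpose_mult[of _ m n _ n]) (use Uh Vh S in auto)
  also have "(Uh * S)\<^sup>T = S\<^sup>T * Uh\<^sup>T" by (rule transpose_mult[OF Uh(1) S])
  finally have At_eq: "A\<^sup>T = Vh * (S\<^sup>T * Uh\<^sup>T)" by simp
  have unit: "X\<^sup>T *\<^sub>v col X r = unit_vec l r"
    if X: "X \<in> carrier_mat l l" "X\<^sup>T * X = 1\<^sub>m l" and r: "r < l" for X :: "real mat" and l r
    using col_mult2[of "X\<^sup>T" l l X l r] X r by simp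
  have At_U: "A\<^sup>T *\<^sub>v col Uh r = Vh *\<^sub>v (S\<^sup>T *\<^sub>v unit_vec m r)" if r: "r < m" for r
  proof -
    have ur: "col Uh r \<in> carrier_vec m" using Uh r by simp
    have "A\<^sup>T *\<^sub>v col Uh r = Vh *\<^sub>v ((S\<^sup>T * Uh\<^sup>T) *\<^sub>v col Uh r)"
      unfolding At_eq by (rule assoc_mult_mat_vec[OF Vh(1) _ ur]) (use S Uh in simp)
    also have "(S\<^sup>T * Uh\<^sup>T) *\<^sub>v col Uh r = S\<^sup>T *\<^sub>v (Uh\<^sup>T *\<^sub>v col Uh r)"
      by (rule assoc_mult_mat_vec[OF _ _ ur]) (use S Uh in auto)
    finally show ?thesis unfolding unit[OF Uh r] .
  qed
  have A_V: "A *\<^sub>v col Vh r = Uh *\<^sub>v (S *\<^sub>v unit_vec n r)" if r: "r < n" for r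
  proof -
    have vr: "col Vh r \<in> carrier_vec n" using Vh r by simp
    have "A *\<^sub>v col Vh r = (Uh * S) *\<^sub>v (Vh\<^sup>T *\<^sub>v col Vh r)"
      unfolding A_eq by (rule assoc_mult_mat_vec[OF _ _ vr]) (use S Uh Vh in auto)
    also have "\<dots> = Uh *\<^sub>v (S *\<^sub>v unit_vec n r)"
      unfolding unit[OF Vh r] by (rule assoc_mult_mat_vec[OF Uh(1) S]) simp
    finally show ?thesis .
  qed
  have St: "S\<^sup>T *\<^sub>v unit_vec m r = \<tau> r \<cdot>\<^sub>v unit_vec n r" if "r < n" for r
    using that nm mult_unit_vec[of "S\<^sup>T" n m r] S by (intro eq_vecI) (auto simp: S_def)
  have S_unit: "S *\<^sub>v unit_vec n r = \<tau> r \<cdot>\<^sub>v unit_vec m r" if "r < n" for r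
    using that nm mult_unit_vec[OF S that] by (intro eq_vecI) (auto simp: S_def)
  have St0: "S\<^sup>T *\<^sub>v unit_vec m r = 0\<^sub>v n" if "n \<le> r" "r < m" for r
    using that mult_unit_vec[of "S\<^sup>T" n m r] S by (intro eq_vecI) (auto simp: S_def)
  show ?thesis
  proof (rule that)
    show "\<tau> (d i + l) = \<sigma> i" if "i \<in> {1..s}" "l < c i" for i l
      using \<tau>(2) that by blast
    show "A\<^sup>T *\<^sub>v col Uh r = \<tau> r \<cdot>\<^sub>v col Vh r" if "r < n" for r
      using At_U[of r] that nm St[OF that] by (simp add: mult_mat_vec[OF Vh(1)] mult_unit_vec[OF Vh(1)])
    show "A *\<^sub>v col Vh r = \<tau> r \<cdot>\<^sub>v col Uh r" if "r < n" for r
      using A_V[OF that] that nm S_unit[OF that] by (simp add: mult_mat_vec[OF Uh(1)] mult_unit_vec[OF Uh(1)])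
    show "A\<^sup>T *\<^sub>v col Uh r = 0\<^sub>v n" if "n \<le> r" "r < m" for r
      using At_U[of r] that St0[OF that] Vh(1) by (intro eq_vecI) auto
  qed
qed

abbreviation "u \<equiv> svd_u c Uh b"
abbreviation "blk \<equiv> col_block c Uh"

lemma blk_carrier: "blk i \<in> carrier_mat m (c i)"
  using Uh mat_of_cols_carrier(1)[of m "map (col Uh) [d i..<d i + c i]"]
  by (simp add: col_block_def)

lemma col_blk:
  assumes "i \<in> {1..s}" "l < c i"
  shows "col (blk i) l = col Uh (d i + l)"
proof -
  have "dim_row Uh = m" "col Uh (d i + l) \<in> carrier_vec m"
    using Uh block_index[OF assms] nm by auto
  thus ?thesis
    using assms(2) col_mat_of_cols[of l "map (col Uh) [d i..<d i + c i]" m]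
    unfolding col_block_def Let_def by (simp del: sum.op_ivl_Suc One_nat_def)
qed

lemma blk_b: "(blk i)\<^sup>T *\<^sub>v b \<in> carrier_vec (c i)"
  using blk_carrier[of i] b by simp

lemma u_eq: "u i = (1 / vnorm ((blk i)\<^sup>T *\<^sub>v b)) \<cdot>\<^sub>v (blk i *\<^sub>v ((blk i)\<^sup>T *\<^sub>v b))"
  by (simp add: svd_u_def Let_def)

lemma u_carrier: "u i \<in> carrier_vec m"
  using blk_carrier[of i] by (simp add: u_eq carrier_vecI)

lemma vnorm_blk_b: "i \<in> {1..s} \<Longrightarrow> vnorm ((blk i)\<^sup>T *\<^sub>v b) \<noteq> 0"
  using vnorm_eq_0_iff[OF blk_b, of i] projections by blast

lemma u_b: "i \<in> {1..s} \<Longrightarrow> u i \<bullet> b = vnorm ((blk i)\<^sup>T *\<^sub>v b)"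
proof -
  assume i: "i \<in> {1..s}"
  let ?w = "(blk i)\<^sup>T *\<^sub>v b"
  have bw: "blk i *\<^sub>v ?w \<in> carrier_vec m" using blk_carrier[of i] blk_b by simp
  have "(blk i *\<^sub>v ?w) \<bullet> b = b \<bullet> (blk i *\<^sub>v ?w)"
    by (rule comm_scalar_prod[OF bw b])
  also have "\<dots> = ?w \<bullet> ?w"
    by (rule transpose_vec_mult_scalar[OF blk_carrier blk_b b, symmetric])
  finally have "u i \<bullet> b = (1 / vnorm ?w) * (vnorm ?w)\<^sup>2"
    using bw b by (simp add: u_eq vnorm_power2)
  thus ?thesis using vnorm_blk_b[OF i] by (simp add: power2_eq_square)
qed

text \<open>\<open>u i\<close> lies in the range of a block whose columns are all eigenvectors of
  \<open>A A^T\<close> for the same eigenvalue.\<close>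

lemma u_eigenvector:
  assumes i: "i \<in> {1..s}"
  shows "A *\<^sub>v (A\<^sup>T *\<^sub>v u i) = (\<sigma> i)\<^sup>2 \<cdot>\<^sub>v u i"
proof -
  obtain \<tau> where \<tau>: "\<And>i l. i \<in> {1..s} \<Longrightarrow> l < c i \<Longrightarrow> \<tau> (d i + l) = \<sigma> i"
    "\<And>r. r < n \<Longrightarrow> A\<^sup>T *\<^sub>v col Uh r = \<tau> r \<cdot>\<^sub>v col Vh r"
    "\<And>r. r < n \<Longrightarrow> A *\<^sub>v col Vh r = \<tau> r \<cdot>\<^sub>v col Uh r"
    using singular_vectors by metis
  let ?w = "(1 / vnorm ((blk i)\<^sup>T *\<^sub>v b)) \<cdot>\<^sub>v ((blk i)\<^sup>T *\<^sub>v b)"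
  have w: "?w \<in> carrier_vec (c i)" using blk_b by simp
  have u: "u i = blk i *\<^sub>v ?w"
    by (simp add: u_eq mult_mat_vec[OF blk_carrier blk_b])
  have AAt: "A * A\<^sup>T \<in> carrier_mat m m" using A by simp
  have "(A * A\<^sup>T) * blk i = (\<sigma> i)\<^sup>2 \<cdot>\<^sub>m blk i"
  proof (rule mat_col_eqI)
    fix l assume "l < dim_col ((\<sigma> i)\<^sup>2 \<cdot>\<^sub>m blk i)"
    hence l: "l < c i" using blk_carrier[of i] by simp
    let ?r = "d i + l"
    have r: "?r < n" by (rule block_index[OF i l])
    have c: "col Uh ?r \<in> carrier_vec m" "col Vh ?r \<in> carrier_vec n"
      using Uh Vh r nm by auto
    have "col ((A * A\<^sup>T) * blk i) l = (A * A\<^sup>T) *\<^sub>v col Uh ?r"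
      using col_mult2[OF AAt blk_carrier l] col_blk[OF i l] by simp
    also have "\<dots> = A *\<^sub>v (A\<^sup>T *\<^sub>v col Uh ?r)"
      by (rule assoc_mult_mat_vec[OF A _ c(1)]) (use A in simp)
    also have "\<dots> = (\<sigma> i)\<^sup>2 \<cdot>\<^sub>v col Uh ?r"
      using \<tau>(2,3)[OF r] \<tau>(1)[OF i l] mult_mat_vec[OF A c(2)]
      by (simp add: smult_smult_assoc power2_eq_square)
    also have "\<dots> = col ((\<sigma> i)\<^sup>2 \<cdot>\<^sub>m blk i) l"
      using col_blk[OF i l] l blk_carrier[of i] by simp
    finally show "col ((A * A\<^sup>T) * blk i) l = col ((\<sigma> i)\<^sup>2 \<cdot>\<^sub>m blk i) l" .
  qed (use A blk_carrier[of i] in auto)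
  hence "(A * A\<^sup>T) *\<^sub>v u i = ((\<sigma> i)\<^sup>2 \<cdot>\<^sub>m blk i) *\<^sub>v ?w"
    unfolding u using assoc_mult_mat_vec[OF AAt blk_carrier w] by simp
  also have "\<dots> = (\<sigma> i)\<^sup>2 \<cdot>\<^sub>v u i"
    unfolding u using blk_carrier[of i] w by (intro eq_vecI) (auto simp: smult_scalar_prod_distrib[of _ "c i"])
  also have "(A * A\<^sup>T) *\<^sub>v u i = A *\<^sub>v (A\<^sup>T *\<^sub>v u i)"
    by (rule assoc_mult_mat_vec[OF A _ u_carrier]) (use A in simp)
  finally show ?thesis .
qed

text \<open>Expand \<open>b\<close> in the columns of \<open>Uh\<close>. Those from position
  \<open>n\<close> on are annihilated by \<open>A^T\<close>, and block \<open>i\<close> contributes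
  the projection of \<open>b\<close> onto its range, which is \<open>u i \<bullet> b\<close> times
  \<open>u i\<close> by the choice of \<open>u i\<close>.\<close>

lemma At_b_expansion:
  assumes t: "t < n"
  shows "(A\<^sup>T *\<^sub>v b) $ t = (\<Sum>i\<in>{1..s}. (u i \<bullet> b) * (A\<^sup>T *\<^sub>v u i) $ t)"
proof -
  have At: "A\<^sup>T \<in> carrier_mat n m" using A by simp
  have zero: "A\<^sup>T *\<^sub>v col Uh r = 0\<^sub>v n" if "n \<le> r" "r < m" for r
    using singular_vectors that by metis
  define f where "f r = (A\<^sup>T *\<^sub>v col Uh r) $ t * (col Uh r \<bullet> b)" for r
  have Ut: "Uh\<^sup>T \<in> carrier_mat m m" using Uh by simp
  have "Uh * Uh\<^sup>T = 1\<^sub>m m"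
    by (rule mat_mult_left_right_inverse[OF Ut Uh])
  hence b_eq: "b = Uh *\<^sub>v (Uh\<^sup>T *\<^sub>v b)"
    using assoc_mult_mat_vec[OF Uh(1) Ut b] b by simp
  have "(A\<^sup>T *\<^sub>v b) = (A\<^sup>T * Uh) *\<^sub>v (Uh\<^sup>T *\<^sub>v b)"
    by (subst b_eq, rule assoc_mult_mat_vec[OF At Uh(1), symmetric]) (use Ut b in simp)
  also have "\<dots> $ t = (\<Sum>r<m. f r)"
    unfolding f_def by (rule mult_transpose_index[OF At Uh(1) b t])
  also have "\<dots> = (\<Sum>r<n. f r)"
    by (rule sum.mono_neutral_right) (use nm zero t in \<open>auto simp: f_def\<close>)
  also have "\<dots> = (\<Sum>i=1..s. \<Sum>l<c i. f (d i + l))"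
    using sum_blocks[of f c s] unfolding multiplicities(1) .
  also have "\<dots> = (\<Sum>i=1..s. (u i \<bullet> b) * (A\<^sup>T *\<^sub>v u i) $ t)"
  proof (rule sum.cong[OF refl])
    fix i assume i: "i \<in> {1..s}"
    let ?w = "(blk i)\<^sup>T *\<^sub>v b"
    have bw: "blk i *\<^sub>v ?w \<in> carrier_vec m" using blk_carrier[of i] blk_b by simp
    have "A\<^sup>T *\<^sub>v u i = (1 / vnorm ?w) \<cdot>\<^sub>v (A\<^sup>T *\<^sub>v (blk i *\<^sub>v ?w))"
      by (simp add: u_eq mult_mat_vec[OF At bw])
    hence "(u i \<bullet> b) * (A\<^sup>T *\<^sub>v u i) $ t = (A\<^sup>T *\<^sub>v (blk i *\<^sub>v ?w)) $ t"
      using u_b[OF i] vnorm_blk_b[OF i] t A by simp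
    also have "\<dots> = ((A\<^sup>T * blk i) *\<^sub>v ?w) $ t"
      using assoc_mult_mat_vec[OF At blk_carrier blk_b] by simp
    also have "\<dots> = (\<Sum>l<c i. f (d i + l))"
      unfolding mult_transpose_index[OF At blk_carrier b t]
      by (rule sum.cong[OF refl]) (simp add: f_def col_blk[OF i])
    finally show "(\<Sum>l<c i. f (d i + l)) = (u i \<bullet> b) * (A\<^sup>T *\<^sub>v u i) $ t" by simp
  qed
  finally show ?thesis .
qed

sublocale spectral_bidiagonalization A b m n s \<sigma> u
proof
  show "inj_on \<sigma> {1..s}"
    using svd unfolding grouped_svd_def inj_on_def by (metis less_irrefl linorder_neqE_nat)
  show "u i \<bullet> b \<noteq> 0" if "i \<in> {1..s}" for i
    using u_b[OF that] vnorm_blk_b[OF that] by simp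
qed (use A b svd u_carrier u_eigenvector At_b_expansion in \<open>auto simp: grouped_svd_def\<close>)

lemma modified_mat_eq:
  assumes W: "svd_completion m s c Uh b W"
  shows "modified_mat A s \<sigma> c Uh b W = A * Z"
proof -
  have len: "length (W i) = c i - 1" if "i \<in> {1..s}" for i
    using W that by (simp add: svd_completion_def)
  \<comment> \<open>The subtraction is truncated, so the count needs every multiplicity to be at
    least 1. The \<open>s\<close> leading columns and the completions then make up exactly
    \<open>n\<close> columns.\<close>
  have total: "(\<Sum>i=1..s. c i - 1) + s = n"
  proof -
    have "(\<Sum>i=1..s. c i - 1) + s = (\<Sum>i=1..s. (c i - 1) + 1)"
      by (subst sum.distrib) simp
    also have "\<dots> = (\<Sum>i=1..s. c i)"
      using multiplicities(2) by (intro sum.cong[OF refl]) (metis le_add_diff_inverse2)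
    finally show ?thesis
      using multiplicities(1) by (simp add: atLeastLessThanSuc_atLeastAtMost)
  qed
  have concat: "length (concat (map g [1..<Suc s])) = n - s"
    if "\<And>i. i \<in> {1..s} \<Longrightarrow> length (g i) = c i - 1" for g :: "nat \<Rightarrow> real vec list"
  proof -
    have "length (concat (map g [1..<Suc s])) = (\<Sum>i=1..s. length (g i))"
      by (simp add: length_concat o_def interv_sum_list_conv_sum_set_nat atLeastLessThanSuc_atLeastAtMost del: upt_Suc)
    also have "\<dots> = (\<Sum>i=1..s. c i - 1)"
      by (rule sum.cong[OF refl]) (use that in simp)
    finally show ?thesis using total by simp
  qed
  show ?thesis
    unfolding modified_mat_def modified_U_def modified_V_def
    using modified_eq_A_Z[of "concat (map W [1..<Suc s])"
        "concat (map (\<lambda>i. map (right_vec A (\<sigma> i)) (W i)) [1..<Suc s])"]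
      concat[of W] concat[of "\<lambda>i. map (right_vec A (\<sigma> i)) (W i)"] len total A
    by (simp del: upt_Suc)
qed

end

theorem theorem3p1:
  fixes m n s k :: nat
    and A Uh Vh :: "real mat"
    and \<sigma> :: "nat \<Rightarrow> real"
    and c :: "nat \<Rightarrow> nat"
    and W :: "nat \<Rightarrow> real vec list"
    and \<Omega> :: "'w measure"
    and \<eta> :: real
    and E :: "'w \<Rightarrow> real vec"
    and \<omega> :: 'w
    and b b_true e x_true :: "real vec"
  defines "A' \<equiv> modified_mat A s \<sigma> c Uh b W"
    and "P \<equiv> gk_P A b s k"
    and "B \<equiv> gk_B A b s k"
    and "Q \<equiv> gk_Q A b k"
    and "x \<equiv> lsqr_iterate A b k"
    and "y \<equiv> lsqr_y A b s k"
  assumes "n \<le> m"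
    and "A \<in> carrier_mat m n"
    and "b_true \<in> carrier_vec m"
    and "gaussian_white_noise \<Omega> \<eta> m E" and "\<omega> \<in> space \<Omega>" and "e = E \<omega>"
    and "b = b_true + e"
    and "vnorm e < vnorm b_true"
    and "x_true = moore_penrose A *\<^sub>v b_true"
    and "grouped_svd m n A s \<sigma> c Uh Vh"
    and "\<forall>i\<in>{1..s}. (col_block c Uh i)\<^sup>T *\<^sub>v b \<noteq> 0\<^sub>v (c i)"
    and "svd_completion m s c Uh b W"
    and "k \<in> {1..s}"
  shows "min_norm_ls_solution (P * B * Q\<^sup>T) b x \<and>
         (\<forall>x'. min_norm_ls_solution (P * B * Q\<^sup>T) b x' \<longrightarrow> x' = x) \<and>
         regularized_solution A' b k P B Q x \<and>
         regularized_solution A b k P B Q x \<and>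
         vnorm (A *\<^sub>v x - b) = vnorm (A' *\<^sub>v x - b) \<and>
         vnorm (A' *\<^sub>v x - b) = vnorm (B *\<^sub>v y - gk_rhs A b s k)"
proof -
  have "e \<in> carrier_vec m"
    using assms(10-12) by (simp add: gaussian_white_noise_def)
  hence b: "b \<in> carrier_vec m" using assms(9,13) by simp
  interpret svd_setting m n A s \<sigma> c Uh Vh b
    using assms(7,8,16,17) b by unfold_locales
  have A'_eq: "A' = A * Z"
    unfolding A'_def by (rule modified_mat_eq[OF assms(18)])
  moreover have "A * Z \<in> carrier_mat m n"
    by (rule mult_carrier_mat[OF assms(8) Z])
  ultimately have A': "A' \<in> carrier_mat m n" by simp
  note props = lsqr_properties[OF assms(19) A' A'_eq, folded P_def B_def Q_def x_def y_def]
  show ?thesis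
    unfolding regularized_solution_def using props by blast
qed

end
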